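(* Let $0<\alpha<n$, $1<p<n/\alpha$, $0\leq\lambda<n-\alpha p$, $\frac1q=\frac1p-\frac{\alpha}{n}$ and $\frac{\lambda}{p}=\frac{\mu}{q}$. Let $T^\alpha$ be any of the operators $I^\alpha$, $M^\alpha$, $H^\alpha$, $\mathcal{H}^\alpha$. Then $T^\alpha$ is bounded from $V_\infty L^{p,\lambda}(\mathbb{R}^n)$ into $V_\infty L^{q,\mu}(\mathbb{R}^n)$; that is, $T^\alpha f\in V_\infty L^{q,\mu}(\mathbb{R}^n)$ for every $f\in V_\infty L^{p,\lambda}(\mathbb{R}^n)$, and $\|T^\alpha f\|_{q,\mu}\leq C\|f\|_{p,\lambda}$ with $C$ independent of $f$.
   Context: For $1\le p<\infty$, $0\le\lambda\le n$, $x\in\mathbb{R}^n$, $r>0$, let $B(x,r)$ be the open ball and $\mathfrak{M}_{p,\lambda}(f;x,r):=\frac{1}{r^\lambda}\int_{B(x,r)}|f(y)|^p\,dy$. The Morrey space $L^{p,\lambda}(\mathbb{R}^n)$ consists of all locally $p$-integrable $f$ on $\mathbb{R}^n$ with $\|f\|_{p,\lambda}:=\sup_{x\in\mathbb{R}^n,\,r>0}\mathfrak{M}_{p,\lambda}(f;x,r)^{1/p}<\infty$. The subspace $V_\infty L^{p,\lambda}(\mathbb{R}^n)$ consists of all $f\in L^{p,\lambda}(\mathbb{R}^n)$ with $\lim_{r\to\infty}\sup_{x\in\mathbb{R}^n}\mathfrak{M}_{p,\lambda}(f;x,r)=0$. Operators, for $0<\alpha<n$: - Riesz potential $I^\alpha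 f(x):=\int_{\mathbb{R}^n}\frac{f(y)}{|x-y|^{n-\alpha}}\,dy$; - fractional maximal operator $M^\alpha f(x):=\sup_{t>0}\frac{1}{|B(x,t)|^{1-\alpha/n}}\int_{B(x,t)}|f(y)|\,dy$; - Hardy type operators $H^\alpha f(x):=|x|^{\alpha-n}\int_{|y|<|x|}f(y)\,dy$ and $\mathcal{H}^\alpha f(x):=|x|^\alpha\int_{|y|>|x|}\frac{f(y)}{|y|^n}\,dy$. *)

theory Defs
  imports "HOL-Analysis.Analysis"
begin

text \<open>
  The space R^n is any type of class \<open>euclidean_space\<close>, with n = \<open>DIM('a)\<close>. Elements of the
  spaces below are functions, not classes modulo equality almost everywhere; all notions involved
  are invariant under changing a function on a null set.
\<close>

definition locally_p_integrable ::
  "real \<Rightarrow> ('a::euclidean_space \<Rightarrow> 'b::real_normed_vector) \<Rightarrow> bool" where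
  "locally_p_integrable p f \<longleftrightarrow>
     f \<in> borel_measurable lebesgue \<and>
     (\<forall>K. compact K \<longrightarrow> set_integrable lebesgue K (\<lambda>y. norm (f y) powr p))"

definition morrey_modular ::
  "real \<Rightarrow> real \<Rightarrow> ('a::euclidean_space \<Rightarrow> 'b::real_normed_vector) \<Rightarrow> 'a \<Rightarrow> real \<Rightarrow> real" where
  "morrey_modular p lam f x r =
     1 / r powr lam * (LINT y:ball x r|lebesgue. norm (f y) powr p)"

text \<open>A supremum of reals is meaningful only for bounded sets, so finiteness of the norm is
  expressed by \<open>bdd_above\<close>; \<open>morrey_norm\<close> is to be read only on \<open>morrey_space\<close>.\<close>

definition morrey_space ::
  "real \<Rightarrow> real \<Rightarrow> ('a::euclidean_space \<Rightarrow> 'b::real_normed_vector) set" where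
  "morrey_space p lam = {f. locally_p_integrable p f \<and>
     bdd_above ((\<lambda>(x, r). morrey_modular p lam f x r powr (1 / p)) ` (UNIV \<times> {0<..}))}"

definition morrey_norm ::
  "real \<Rightarrow> real \<Rightarrow> ('a::euclidean_space \<Rightarrow> 'b::real_normed_vector) \<Rightarrow> real" where
  "morrey_norm p lam f =
     (SUP (x, r) \<in> UNIV \<times> {0<..}. morrey_modular p lam f x r powr (1 / p))"

definition vanishing_morrey_space ::
  "real \<Rightarrow> real \<Rightarrow> ('a::euclidean_space \<Rightarrow> 'b::real_normed_vector) set" where
  "vanishing_morrey_space p lam = {f \<in> morrey_space p lam.
     ((\<lambda>r. SUP x. morrey_modular p lam f x r) \<longlongrightarrow> 0) at_top}"

text \<open>
  Since Bochner integrals and real suprema are total functions in HOL, each operator comes with a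
  predicate stating that the defining integral converges absolutely (respectively, that the
  supremum is finite) at the point \<open>x\<close>.
\<close>

definition riesz_potential ::
  "real \<Rightarrow> ('a::euclidean_space \<Rightarrow> 'b::{banach, second_countable_topology}) \<Rightarrow> 'a \<Rightarrow> 'b" where
  "riesz_potential \<alpha> f x =
     (LINT y|lebesgue. f y /\<^sub>R (norm (x - y) powr (real DIM('a) - \<alpha>)))"

definition riesz_potential_defined ::
  "real \<Rightarrow> ('a::euclidean_space \<Rightarrow> 'b::{banach, second_countable_topology}) \<Rightarrow> 'a \<Rightarrow> bool" where
  "riesz_potential_defined \<alpha> f x \<longleftrightarrow>
     integrable lebesgue (\<lambda>y. f y /\<^sub>R (norm (x - y) powr (real DIM('a) - \<alpha>)))"

definition fractional_average ::
  "real \<Rightarrow> ('a::euclidean_space \<Rightarrow> 'b::real_normed_vector) \<Rightarrow> 'a \<Rightarrow> real \<Rightarrow> real" where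
  "fractional_average \<alpha> f x t =
     1 / measure lebesgue (ball x t) powr (1 - \<alpha> / real DIM('a)) *
       (LINT y:ball x t|lebesgue. norm (f y))"

definition fractional_maximal ::
  "real \<Rightarrow> ('a::euclidean_space \<Rightarrow> 'b::real_normed_vector) \<Rightarrow> 'a \<Rightarrow> real" where
  "fractional_maximal \<alpha> f x = (SUP t \<in> {0<..}. fractional_average \<alpha> f x t)"

definition fractional_maximal_defined ::
  "real \<Rightarrow> ('a::euclidean_space \<Rightarrow> 'b::real_normed_vector) \<Rightarrow> 'a \<Rightarrow> bool" where
  "fractional_maximal_defined \<alpha> f x \<longleftrightarrow>
     (\<forall>t>0. set_integrable lebesgue (ball x t) (\<lambda>y. norm (f y))) \<and>
     bdd_above (fractional_average \<alpha> f x ` {0<..})"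

definition hardy_inner ::
  "real \<Rightarrow> ('a::euclidean_space \<Rightarrow> 'b::{banach, second_countable_topology}) \<Rightarrow> 'a \<Rightarrow> 'b" where
  "hardy_inner \<alpha> f x =
     norm x powr (\<alpha> - real DIM('a)) *\<^sub>R (LINT y:{y. norm y < norm x}|lebesgue. f y)"

definition hardy_inner_defined ::
  "real \<Rightarrow> ('a::euclidean_space \<Rightarrow> 'b::{banach, second_countable_topology}) \<Rightarrow> 'a \<Rightarrow> bool" where
  "hardy_inner_defined \<alpha> f x \<longleftrightarrow> set_integrable lebesgue {y. norm y < norm x} f"

definition hardy_outer ::
  "real \<Rightarrow> ('a::euclidean_space \<Rightarrow> 'b::{banach, second_countable_topology}) \<Rightarrow> 'a \<Rightarrow> 'b" where
  "hardy_outer \<alpha> f x =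
     norm x powr \<alpha> *\<^sub>R (LINT y:{y. norm y > norm x}|lebesgue. f y /\<^sub>R (norm y ^ DIM('a)))"

definition hardy_outer_defined ::
  "real \<Rightarrow> ('a::euclidean_space \<Rightarrow> 'b::{banach, second_countable_topology}) \<Rightarrow> 'a \<Rightarrow> bool" where
  "hardy_outer_defined \<alpha> f x \<longleftrightarrow>
     set_integrable lebesgue {y. norm y > norm x} (\<lambda>y. f y /\<^sub>R (norm y ^ DIM('a)))"

text \<open>The operator \<open>T\<close>, whose values are meaningful where \<open>D\<close> holds, is defined almost everywhere
  on, and bounded between, the vanishing Morrey spaces.\<close>

definition bounded_vanishing_morrey ::
  "real \<Rightarrow> real \<Rightarrow> real \<Rightarrow> real \<Rightarrow>
   (('a::euclidean_space \<Rightarrow> 'b::real_normed_vector) \<Rightarrow> 'a \<Rightarrow> bool) \<Rightarrow>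
   (('a \<Rightarrow> 'b) \<Rightarrow> 'a \<Rightarrow> 'c::real_normed_vector) \<Rightarrow> bool" where
  "bounded_vanishing_morrey p lam q \<mu> D T \<longleftrightarrow>
     (\<forall>f \<in> vanishing_morrey_space p lam.
        (AE x in lebesgue. D f x) \<and> T f \<in> vanishing_morrey_space q \<mu>) \<and>
     (\<exists>C. \<forall>f \<in> vanishing_morrey_space p lam. morrey_norm q \<mu> (T f) \<le> C * morrey_norm p lam f)"

end

theory Submission
  imports Defs
begin

text \<open>
  All four operators are dominated pointwise by a multiple of the Riesz potential of \<open>norm \<circ> f\<close>, so
  everything rests on one estimate of that potential on a ball \<open>B(x0, r)\<close>. Outside \<open>B(x0, 2r)\<close> one
  uses Hoelder's inequality with power weights centred at \<open>x0\<close>. Inside \<open>B(x0, 2r)\<close> no maximal function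
  is needed: vanishing at infinity forces \<open>f = 0\<close> almost everywhere if \<open>lam = 0\<close>, and \<open>lam > 0\<close>
  leaves room in the exponents. Indeed, write \<open>z = x - y\<close> and split
    \<open>f(y) |z|^(\<alpha> - n) = (f(y)^p |z|^(-t lam))^(\<alpha>/n) (f(y)^p |z|^(-t n))^(1/q) (|z|^(-t n))^(1 - 1/p)\<close>
  with \<open>t = (n - \<alpha>) / (n - \<alpha> + lam \<alpha>/n) < 1\<close>. In Hoelder's inequality in \<open>y\<close> the first factor is
  controlled by the Morrey bound and the third is locally integrable, while the second becomes
  integrable in \<open>x\<close> after taking \<open>q\<close>-th powers, by Tonelli. The resulting bound for the \<open>q\<close>-modular
  on \<open>B(x0, r)\<close> is linear in the supremum of the \<open>p\<close>-modulars with radius at least \<open>r\<close>, so it vanishes as \<open>r\<close> tends to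
  infinity.
\<close>

section \<open>Lebesgue measure\<close>

text \<open>Balls of integer radius cover the space and have finite measure. Sigma-finiteness is
  needed for Tonelli's theorem and for the measurability in \<open>x\<close> of integrals over
  \<open>y\<close>.\<close>

lemma sigma_finite_lebesgue: "sigma_finite_measure (lebesgue :: 'a::euclidean_space measure)"
proof
  have "(\<Union>n. ball 0 (real n)) = (UNIV :: 'a set)"
    using reals_Archimedean2 by auto


  then show "\<exists>A. countable A \<and> A \<subseteq> sets (lebesgue :: 'a measure) \<and> \<Union> A = space lebesgue \<and>
      (\<forall>a\<in>A. emeasure lebesgue a \<noteq> \<infinity>)"
    by (intro exI[of _ "range (\<lambda>n. ball 0 (real n))"])
      (simp add: fmeasurableD emeasure_ball image_subset_iff)
qed

lemma pair_sigma_finite_lebesgue: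
  "pair_sigma_finite (lebesgue :: 'a::euclidean_space measure) (lebesgue :: 'b::euclidean_space measure)"
  by (simp add: pair_sigma_finite_def sigma_finite_lebesgue)

text \<open>Borel sets are Lebesgue measurable, so coordinates remain Borel measurable on products
  with the completed measure. With these rules kernels such as \<open>norm (x - y)\<close> are seen
  to be jointly measurable.\<close>

lemma borel_measurable_lebesgue_fst [measurable]:
  "fst \<in> borel_measurable ((lebesgue :: 'a::euclidean_space measure) \<Otimes>\<^sub>M N)"
  using measurable_compose[OF measurable_fst, of "\<lambda>x. x" lebesgue borel N]
  by (simp add: measurable_completion)

lemma borel_measurable_lebesgue_snd [measurable]:
  "snd \<in> borel_measurable (N \<Otimes>\<^sub>M (lebesgue :: 'a::euclidean_space measure))"
  using measurable_compose[OF measurable_snd, of "\<lambda>x. x" lebesgue borel N]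
  by (simp add: measurable_completion)

lemma borel_measurable_lebesgue_ident [measurable]:
  "(\<lambda>x. x) \<in> borel_measurable (lebesgue :: 'a::euclidean_space measure)"
  by (simp add: measurable_completion)

lemma sets_lebesgue_ball [measurable]: "ball x r \<in> sets (lebesgue :: 'a::euclidean_space measure)"
  by (simp add: fmeasurableD)

section \<open>Power weights and Hoelder's inequality\<close>

text \<open>The common core of the two dyadic estimates below. Every \<open>y\<close> in
  \<open>S\<close> other than \<open>x\<close> lies in some ball of radius \<open>s k\<close> and
  has weight at most \<open>w k\<close>, so the integrand is dominated by the sum over all
  \<open>k\<close> of \<open>w k * h\<close> restricted to these balls. Integrating termwise leaves
  a geometric series.\<close>

lemma nn_integral_power_weight_cover:
  fixes h :: "'a::euclidean_space \<Rightarrow> real"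
  assumes [measurable]: "h \<in> borel_measurable lebesgue" "S \<in> sets lebesgue"
    and h0: "\<And>y. 0 \<le> h y" and "0 \<le> D" "0 < g" "g < 1"
    and ball: "\<And>k::nat. (\<integral>\<^sup>+y. ennreal (h y) * indicator (ball x (s k)) y \<partial>lebesgue) \<le> ennreal (m k)"
    and wm: "\<And>k. 0 \<le> w k" "\<And>k. w k * m k \<le> D * g ^ k"
    and cover: "\<And>y. y \<in> S \<Longrightarrow> y \<noteq> x \<Longrightarrow> \<exists>k. norm (x - y) < s k \<and> norm (x - y) powr (-\<beta>) \<le> w k"
  shows "(\<integral>\<^sup>+y. ennreal (h y * norm (x - y) powr (-\<beta>)) * indicator S y \<partial>lebesgue) \<le> ennreal (D / (1 - g))"
proof -
  have "(\<integral>\<^sup>+y. ennreal (h y * norm (x - y) powr (-\<beta>)) * indicator S y \<partial>lebesgue)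
      \<le> (\<integral>\<^sup>+y. (\<Sum>k. ennreal (w k) * (ennreal (h y) * indicator (ball x (s k)) y)) \<partial>lebesgue)"
  proof (rule nn_integral_mono)
    fix y
    show "ennreal (h y * norm (x - y) powr (-\<beta>)) * indicator S y
        \<le> (\<Sum>k. ennreal (w k) * (ennreal (h y) * indicator (ball x (s k)) y))"
    proof (cases "y \<in> S \<and> y \<noteq> x")
      case True
      then obtain k where k: "norm (x - y) < s k" "norm (x - y) powr (-\<beta>) \<le> w k"
        using cover by blast
      have "ennreal (h y * norm (x - y) powr (-\<beta>)) \<le> ennreal (w k) * ennreal (h y)"
        using k h0[of y] by (simp add: ennreal_mult[symmetric] wm mult.commute[of "h y"] mult_right_mono)
      also have "\<dots> = (\<Sum>j\<in>{k}. ennreal (w j) * (ennreal (h y) * indicator (ball x (s j)) y))"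
        using k by (simp add: dist_norm)
      also have "\<dots> \<le> (\<Sum>k. ennreal (w k) * (ennreal (h y) * indicator (ball x (s k)) y))"
        by (rule sum_le_suminf) auto
      finally show ?thesis using True by simp
    \<comment> \<open>For \<open>y = x\<close> the left side vanishes too, because
      \<open>0 powr (-\<beta>) = 0\<close>.\<close>
    qed auto
  qed
  also have "\<dots> = (\<Sum>k. ennreal (w k) * (\<integral>\<^sup>+y. ennreal (h y) * indicator (ball x (s k)) y \<partial>lebesgue))"
    by (subst nn_integral_suminf) (auto simp: nn_integral_cmult)
  also have "\<dots> \<le> (\<Sum>k. ennreal (D * g ^ k))"
  proof (rule suminf_le)
    fix k
    have "ennreal (w k) * (\<integral>\<^sup>+y. ennreal (h y) * indicator (ball x (s k)) y \<partial>lebesgue)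
        \<le> ennreal (w k) * ennreal (m k)"
      by (intro mult_left_mono ball) auto
    \<comment> \<open>A negative \<open>m k\<close> is harmless: truncation in
      \<open>ennreal\<close> then makes both sides 0.\<close>
    also have "\<dots> = ennreal (w k * m k)"
      by (cases "0 \<le> m k") (auto simp: ennreal_mult wm ennreal_neg mult_nonneg_nonpos)
    also have "\<dots> \<le> ennreal (D * g ^ k)"
      by (intro ennreal_leI wm)
    finally show "ennreal (w k) * (\<integral>\<^sup>+y. ennreal (h y) * indicator (ball x (s k)) y \<partial>lebesgue)
      \<le> ennreal (D * g ^ k)" .
  qed auto
  also have "\<dots> = ennreal (D / (1 - g))"
    using assms(4-6) sums_mult[OF geometric_sums[of g], of D]
    by (intro suminf_ennreal_eq) auto
  finally show ?thesis .
qed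

text \<open>The factor \<open>2 powr c\<close> is the loss within one dyadic shell, the rest is the
  sum of the geometric series of ratio \<open>2 powr (-e)\<close>. Here \<open>e\<close> is the gap
  between the growth exponent of the mass and the exponent of the weight.\<close>

definition dyadic_const :: "real \<Rightarrow> real \<Rightarrow> real" where
  "dyadic_const c e = 2 powr c / (1 - 2 powr (-e))"

lemma dyadic_const_pos: "0 < e \<Longrightarrow> 0 < dyadic_const c e"
  by (simp add: dyadic_const_def powr_less_one)

lemma dyadic_weight_mult:
  fixes R :: real
  assumes "0 < R"
  shows "(2 powr a * R) powr (-\<beta>) * (M * (2 powr b * R) powr l)
    = M * R powr (l - \<beta>) * 2 powr (b * l - a * \<beta>)"
proof -
  have "(2 powr a * R) powr (-\<beta>) * (M * (2 powr b * R) powr l)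
      = M * (R powr l * R powr (-\<beta>)) * (2 powr (b * l) * 2 powr (- (a * \<beta>)))"
    using assms by (simp add: powr_mult powr_powr)
  then show ?thesis by (simp flip: powr_add)
qed

text \<open>Dyadic shells shrinking to \<open>x\<close>: on the scale
  \<open>t = 2 powr (- k) * R\<close> the mass is of order \<open>t powr l\<close> and the weight of
  order \<open>t powr (-\<beta>)\<close>, so \<open>\<beta> < l\<close> makes the contributions
  decay geometrically.\<close>

lemma nn_integral_power_weight_near:
  fixes h :: "'a::euclidean_space \<Rightarrow> real"
  assumes h: "h \<in> borel_measurable lebesgue" "\<And>y. 0 \<le> h y"
    and pos: "0 < R" "0 \<le> \<beta>" "\<beta> < l" "0 \<le> M"
    and ball: "\<And>t. 0 < t \<Longrightarrow> t \<le> R \<Longrightarrow>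
      (\<integral>\<^sup>+y. ennreal (h y) * indicator (ball x t) y \<partial>lebesgue) \<le> ennreal (M * t powr l)"
  shows "(\<integral>\<^sup>+y. ennreal (h y * norm (x - y) powr (-\<beta>)) * indicator (ball x R) y \<partial>lebesgue)
    \<le> ennreal (dyadic_const \<beta> (l - \<beta>) * M * R powr (l - \<beta>))"
proof -
  let ?s = "\<lambda>k::nat. 2 powr (- real k) * R"
  let ?w = "\<lambda>k::nat. (2 powr (- real k - 1) * R) powr (-\<beta>)"
  let ?g = "2 powr (-(l - \<beta>))"
  have "(\<integral>\<^sup>+y. ennreal (h y * norm (x - y) powr (-\<beta>)) * indicator (ball x R) y \<partial>lebesgue)
    \<le> ennreal ((M * R powr (l - \<beta>) * 2 powr \<beta>) / (1 - ?g))"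
  proof (rule nn_integral_power_weight_cover[where w = ?w and s = ?s and m = "\<lambda>k. M * ?s k powr l"])
    fix k :: nat
    show "(\<integral>\<^sup>+y. ennreal (h y) * indicator (ball x (?s k)) y \<partial>lebesgue) \<le> ennreal (M * ?s k powr l)"
      using pos powr_mono[of "- real k" 0 2] by (intro ball) auto
    have "?g ^ k = 2 powr (-(l - \<beta>) * real k)"
      by (simp add: powr_power mult.commute)
    then have "2 powr \<beta> * ?g ^ k = 2 powr ((- real k) * l - (- real k - 1) * \<beta>)"
      by (simp add: algebra_simps flip: powr_add)
    then show "?w k * (M * ?s k powr l) \<le> (M * R powr (l - \<beta>) * 2 powr \<beta>) * ?g ^ k"
      by (simp only: dyadic_weight_mult[OF \<open>0 < R\<close>] mult.assoc order_refl)
  next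
    fix y assume y: "y \<in> ball x R" "y \<noteq> x"
    let ?d = "norm (x - y)"
    have d: "0 < ?d" "?d < R" using y by (auto simp: dist_norm)
    let ?u = "log 2 (R / ?d)"
    have u: "0 < ?u" using d pos by (subst zero_less_log_cancel_iff) (auto simp: field_simps)
    \<comment> \<open>Rounding up makes \<open>k < ?u\<close> the strict inequality, as membership
      in the open ball of radius \<open>?s k\<close> requires; \<open>0 < ?u\<close> keeps the
      argument of \<open>nat\<close> nonnegative.\<close>
    define k where "k = nat (\<lceil>?u\<rceil> - 1)"
    have k: "real k < ?u" "?u \<le> real k + 1"
      using u unfolding k_def by linarith+
    have "2 powr real k < R / ?d" "R / ?d \<le> 2 powr (real k + 1)"
      using k d pos less_log_iff[of 2 "R / ?d" "real k"] log_le_iff[of 2 "R / ?d" "real k + 1"] by auto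
    then have 1: "?d < ?s k" "2 powr (- real k - 1) * R \<le> ?d"
      using d pos by (simp_all add: powr_minus powr_add powr_diff field_simps)
    have "?d powr (-\<beta>) \<le> ?w k"
      using 1 pos by (intro powr_mono2') auto
    with 1 show "\<exists>k. ?d < ?s k \<and> ?d powr (-\<beta>) \<le> ?w k" by blast
  qed (use h pos in \<open>auto simp: powr_less_one\<close>)
  then show ?thesis by (simp add: dyadic_const_def mult_ac)
qed

text \<open>The same with shells growing to infinity. Now \<open>l < \<beta>\<close> gives the
  decay, and only balls of radius at least \<open>R\<close> enter.\<close>

lemma nn_integral_power_weight_far:
  fixes h :: "'a::euclidean_space \<Rightarrow> real"
  assumes h: "h \<in> borel_measurable lebesgue" "\<And>y. 0 \<le> h y"
    and pos: "0 < R" "0 \<le> l" "l < \<beta>" "0 \<le> M"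
    and ball: "\<And>t. R \<le> t \<Longrightarrow>
      (\<integral>\<^sup>+y. ennreal (h y) * indicator (ball x t) y \<partial>lebesgue) \<le> ennreal (M * t powr l)"
  shows "(\<integral>\<^sup>+y. ennreal (h y * norm (x - y) powr (-\<beta>)) * indicator (- ball x R) y \<partial>lebesgue)
    \<le> ennreal (dyadic_const l (\<beta> - l) * M * R powr (l - \<beta>))"
proof -
  let ?s = "\<lambda>k::nat. 2 powr (real k + 1) * R"
  let ?w = "\<lambda>k::nat. (2 powr (real k) * R) powr (-\<beta>)"
  let ?g = "2 powr (-(\<beta> - l))"
  have "(\<integral>\<^sup>+y. ennreal (h y * norm (x - y) powr (-\<beta>)) * indicator (- ball x R) y \<partial>lebesgue)
    \<le> ennreal ((M * R powr (l - \<beta>) * 2 powr l) / (1 - ?g))"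
  proof (rule nn_integral_power_weight_cover[where w = ?w and s = ?s and m = "\<lambda>k. M * ?s k powr l"])
    fix k :: nat
    show "(\<integral>\<^sup>+y. ennreal (h y) * indicator (ball x (?s k)) y \<partial>lebesgue) \<le> ennreal (M * ?s k powr l)"
      using pos powr_mono[of 0 "real k + 1" 2] by (intro ball) auto
    have "?g ^ k = 2 powr (-(\<beta> - l) * real k)"
      by (simp add: powr_power mult.commute)
    then have "2 powr l * ?g ^ k = 2 powr ((real k + 1) * l - (real k) * \<beta>)"
      by (simp add: algebra_simps flip: powr_add)
    then show "?w k * (M * ?s k powr l) \<le> (M * R powr (l - \<beta>) * 2 powr l) * ?g ^ k"
      by (simp only: dyadic_weight_mult[OF \<open>0 < R\<close>] mult.assoc order_refl)
  next
    fix y assume y: "y \<in> - ball x R" "y \<noteq> x"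
    let ?d = "norm (x - y)"
    have d: "0 < ?d" "R \<le> ?d" using y by (auto simp: dist_norm)
    let ?u = "log 2 (?d / R)"
    have u: "0 \<le> ?u" using d pos by simp
    \<comment> \<open>Here one rounds down, since the open ball has radius
      \<open>2 powr (k + 1) * R\<close> and the strict inequality is needed at
      \<open>k + 1\<close>.\<close>
    define k where "k = nat \<lfloor>?u\<rfloor>"
    have k: "real k \<le> ?u" "?u < real k + 1"
      using u unfolding k_def by linarith+
    have "2 powr real k \<le> ?d / R" "?d / R < 2 powr (real k + 1)"
      using k d pos le_log_iff[of 2 "?d / R" "real k"] log_less_iff[of 2 "?d / R" "real k + 1"] by auto
    then have 1: "?d < ?s k" "2 powr real k * R \<le> ?d"
      using d pos by (simp_all add: powr_add field_simps)
    have "?d powr (-\<beta>) \<le> ?w k"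
      using 1 pos by (intro powr_mono2') auto
    with 1 show "\<exists>k. ?d < ?s k \<and> ?d powr (-\<beta>) \<le> ?w k" by blast
  qed (use h pos in \<open>auto simp: powr_less_one\<close>)
  then show ?thesis by (simp add: dyadic_const_def mult_ac)
qed

text \<open>Young's inequality for \<open>u y / U\<close> and \<open>v y / V\<close>, integrated.
  \<open>U\<close> and \<open>V\<close> may be any finite bounds for the two integrals. If one of
  them is 0, the corresponding function vanishes almost everywhere and so does the product.\<close>

lemma nn_integral_Holder:
  fixes u v :: "'a \<Rightarrow> real"
  assumes [measurable]: "u \<in> borel_measurable M" "v \<in> borel_measurable M"
    and nn: "\<And>y. 0 \<le> u y" "\<And>y. 0 \<le> v y"
    and U: "(\<integral>\<^sup>+y. ennreal (u y) \<partial>M) \<le> ennreal U" "0 \<le> U"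
    and V: "(\<integral>\<^sup>+y. ennreal (v y) \<partial>M) \<le> ennreal V" "0 \<le> V"
    and \<theta>: "0 < \<theta>" "\<theta> < 1"
  shows "(\<integral>\<^sup>+y. ennreal (u y powr \<theta> * v y powr (1 - \<theta>)) \<partial>M) \<le> ennreal (U powr \<theta> * V powr (1 - \<theta>))"
proof (cases "U = 0 \<or> V = 0")
  case True
  then have "AE y in M. u y = 0 \<or> v y = 0"
  proof
    assume "U = 0"
    then have "AE y in M. ennreal (u y) = 0" using U by (subst nn_integral_0_iff_AE[symmetric]) auto
    then show ?thesis by eventually_elim (use nn in \<open>auto simp: ennreal_eq_0_iff antisym\<close>)
  next
    assume "V = 0"
    then have "AE y in M. ennreal (v y) = 0" using V by (subst nn_integral_0_iff_AE[symmetric]) auto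
    then show ?thesis by eventually_elim (use nn in \<open>auto simp: ennreal_eq_0_iff antisym\<close>)
  qed
  then have "AE y in M. ennreal (u y powr \<theta> * v y powr (1 - \<theta>)) = 0"
    by eventually_elim auto
  then have "(\<integral>\<^sup>+y. ennreal (u y powr \<theta> * v y powr (1 - \<theta>)) \<partial>M) = 0"
    by (subst nn_integral_0_iff_AE) auto
  then show ?thesis by simp
next
  case False
  then have pos: "0 < U" "0 < V" using U V by auto
  let ?K = "U powr \<theta> * V powr (1 - \<theta>)"
  have K: "0 < ?K" using pos by simp
  have pt: "u y powr \<theta> * v y powr (1 - \<theta>) \<le> ?K * (\<theta> / U) * u y + ?K * ((1 - \<theta>) / V) * v y" for y
  proof (cases "u y = 0 \<or> v y = 0")
    case True
    then show ?thesis using pos nn[of y] \<theta> K by auto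
  next
    case False
    then have "0 < u y" "0 < v y" using nn[of y] by auto
    then have "(u y / U) powr \<theta> * (v y / V) powr (1 - \<theta>) \<le> \<theta> * (u y / U) + (1 - \<theta>) * (v y / V)"
      using pos \<theta> by (intro Youngs_inequality_0) auto
    then have "?K * ((u y / U) powr \<theta> * (v y / V) powr (1 - \<theta>)) \<le> ?K * (\<theta> * (u y / U) + (1 - \<theta>) * (v y / V))"
      using K by (intro mult_left_mono) auto
    then show ?thesis using pos nn[of y] by (simp add: powr_divide algebra_simps)
  qed
  have "(\<integral>\<^sup>+y. ennreal (u y powr \<theta> * v y powr (1 - \<theta>)) \<partial>M)
      \<le> (\<integral>\<^sup>+y. ennreal (?K * (\<theta> / U)) * ennreal (u y) + ennreal (?K * ((1 - \<theta>) / V)) * ennreal (v y) \<partial>M)"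
    using pos \<theta> nn pt by (intro nn_integral_mono)
      (simp add: ennreal_mult[symmetric] ennreal_plus[symmetric] ennreal_leI del: ennreal_plus)
  also have "\<dots> = ennreal (?K * (\<theta> / U)) * (\<integral>\<^sup>+y. ennreal (u y) \<partial>M)
      + ennreal (?K * ((1 - \<theta>) / V)) * (\<integral>\<^sup>+y. ennreal (v y) \<partial>M)"
    by (simp add: nn_integral_add nn_integral_cmult)
  also have "\<dots> \<le> ennreal (?K * (\<theta> / U)) * ennreal U + ennreal (?K * ((1 - \<theta>) / V)) * ennreal V"
    by (intro add_mono mult_left_mono U V) auto
  also have "\<dots> = ennreal ?K"
    using pos \<theta> by (simp add: ennreal_mult[symmetric] ennreal_plus[symmetric] field_simps del: ennreal_plus)
  finally show ?thesis .
qed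

section \<open>The Riesz potential on balls\<close>

lemma powr_add_le:
  fixes a b q :: real
  assumes "0 \<le> a" "0 \<le> b" "0 \<le> q"
  shows "(a + b) powr q \<le> 2 powr q * (a powr q + b powr q)"
proof -
  have "(a + b) powr q \<le> (2 * max a b) powr q"
    using assms by (intro powr_mono2) auto
  also have "\<dots> = 2 powr q * max a b powr q"
    using assms by (simp add: powr_mult)
  also have "\<dots> \<le> 2 powr q * (a powr q + b powr q)"
    by (intro mult_left_mono) (auto simp: max_def)
  finally show ?thesis .
qed

section \<open>The exponents, the splitting ratios and the constants\<close>

locale spanne_exponents =
  fixes space_type :: "'a::euclidean_space itself" and n \<alpha> p q lam \<mu> :: real
  assumes n_eq: "n = real DIM('a)" and \<alpha>_pos: "0 < \<alpha>" and \<alpha>_less: "\<alpha> < n"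
    and p_gt_1: "1 < p" and p_less: "p < n / \<alpha>"
    and lam_nonneg: "0 \<le> lam" and lam_less: "lam < n - \<alpha> * p"
    and q_eq: "1 / q = 1 / p - \<alpha> / n"
    and \<mu>_eq: "lam / p = \<mu> / q"
begin

lemma nn_integral_ball_one:
  fixes x :: 'a
  assumes "0 < t"
  shows "(\<integral>\<^sup>+y. ennreal 1 * indicator (ball x t) y \<partial>lebesgue) = ennreal (unit_ball_vol n * t powr n)"
  using assms by (simp add: n_eq emeasure_ball powr_realpow)

lemma n_pos: "0 < n"
  using \<alpha>_pos \<alpha>_less by simp

lemma unit_ball_vol_n: "0 < unit_ball_vol n"
  using \<alpha>_pos \<alpha>_less by simp

lemma q_gt_p: "p < q"
proof -
  have "\<alpha> / n < 1 / p" using p_less p_gt_1 \<alpha>_pos \<alpha>_less by (simp add: field_simps)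
  moreover have "0 < \<alpha> / n" using \<alpha>_pos \<alpha>_less by simp
  ultimately have "0 < 1 / q" "1 / q < 1 / p"
    unfolding q_eq by linarith+
  then show ?thesis using p_gt_1 by (simp add: field_simps split: if_splits)
qed

lemma q_pos: "0 < q" using q_gt_p p_gt_1 by simp

lemma mu_alt: "\<mu> = lam * (q / p)"
  using \<mu>_eq q_pos p_gt_1 by (simp add: field_simps)

lemma alpha_alt: "\<alpha> * (q / n) = q / p - 1"
proof -
  have "q * (1 / q) = q * (1 / p) - q * (\<alpha> / n)" unfolding q_eq by (simp add: algebra_simps)
  then show ?thesis using q_pos by (simp add: mult.commute)
qed

lemma n_div_q: "n * (q / p) - q * \<alpha> = n"
proof -
  have "n * (\<alpha> * (q / n)) = n * (q / p - 1)" by (simp only: alpha_alt)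
  then show ?thesis using \<alpha>_pos \<alpha>_less by (simp add: algebra_simps)
qed

text \<open>The \<open>t\<close> of the overview: the factor for which the kernel exponents
  \<open>t * lam * (\<alpha> / n)\<close>, \<open>t * n / q\<close> and
  \<open>t * n * (1 - 1 / p)\<close> add up to \<open>n - \<alpha>\<close>.\<close>

definition near_ratio :: real where
  "near_ratio = (n - \<alpha>) / (n - \<alpha> + lam * (\<alpha> / n))"

text \<open>The factor \<open>s\<close> for which
  \<open>s * lam / p + s * n * (1 - 1 / p) = n - \<alpha>\<close>. Away from \<open>x0\<close> it
  distributes the kernel between \<open>u powr p\<close> and the constant function 1.\<close>

definition far_ratio :: real where
  "far_ratio = (n - \<alpha>) / (lam / p + n * (1 - 1 / p))"

text \<open>A ratio below 1 makes both near weights integrable at the singularity. This is where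
  \<open>0 < lam\<close> enters: for \<open>lam = 0\<close> the ratio is 1, and
  \<open>|z|^(-n)\<close> is not locally integrable.\<close>

lemma near_ratio:
  assumes "0 < lam"
  shows "0 < near_ratio" "near_ratio < 1" "near_ratio * (n - \<alpha> + lam * (\<alpha> / n)) = n - \<alpha>"
proof -
  have "0 < lam * (\<alpha> / n)" using assms \<alpha>_pos \<alpha>_less by simp
  then show "0 < near_ratio" "near_ratio < 1" "near_ratio * (n - \<alpha> + lam * (\<alpha> / n)) = n - \<alpha>"
    using \<alpha>_less by (simp_all add: near_ratio_def)
qed

text \<open>After division by \<open>p\<close>, the assumption \<open>lam < n - \<alpha> * p\<close>
  says exactly that the denominator is smaller than \<open>n - \<alpha>\<close>. A ratio above 1
  gives convergence at infinity.\<close>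

lemma far_ratio: "1 < far_ratio" "far_ratio * (lam / p + n * (1 - 1 / p)) = n - \<alpha>"
proof -
  have 1: "0 < lam / p + n * (1 - 1 / p)"
    using p_gt_1 lam_nonneg n_pos by (intro add_nonneg_pos) auto
  have "lam / p < (n - \<alpha> * p) / p" using lam_less p_gt_1 by (intro divide_strict_right_mono) auto
  then have "lam / p + n * (1 - 1 / p) < n - \<alpha>" using p_gt_1 by (simp add: field_simps)
  then show "1 < far_ratio" "far_ratio * (lam / p + n * (1 - 1 / p)) = n - \<alpha>"
    using 1 by (simp_all add: far_ratio_def)
qed

text \<open>What remains on the left of \<open>near_scaling\<close> once the powers of
  \<open>r\<close>, \<open>B\<close> and \<open>E\<close> are taken out; \<open>far_const\<close>
  plays the same part in \<open>far_scaling\<close>.\<close>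

definition near_const :: real where
  "near_const = (dyadic_const (near_ratio * lam) (lam - near_ratio * lam) * 3 powr (lam - near_ratio * lam)) powr (q / p - 1)
     * (dyadic_const (near_ratio * n) (n - near_ratio * n) * unit_ball_vol n * 3 powr (n - near_ratio * n)) powr (q - q / p)
     * (dyadic_const (near_ratio * n) (n - near_ratio * n) * unit_ball_vol n * 3 powr (n - near_ratio * n) * 2 powr lam)"

definition far_const :: real where
  "far_const = 2 powr ((n - \<alpha>) * q)
     * (dyadic_const lam (far_ratio * lam - lam) * 2 powr (lam - far_ratio * lam)) powr (q / p)
     * (dyadic_const n (far_ratio * n - n) * unit_ball_vol n * 2 powr (n - far_ratio * n)) powr (q - q / p)
     * unit_ball_vol n"

lemma near_const_nonneg: "0 < lam \<Longrightarrow> 0 \<le> near_const"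
  using near_ratio n_pos dyadic_const_pos[of "n - near_ratio * n" "near_ratio * n"]
  by (simp add: near_const_def less_imp_le[OF unit_ball_vol_n])

lemma far_const_nonneg: "0 < lam \<Longrightarrow> 0 \<le> far_const"
  by (simp add: far_const_def less_imp_le[OF unit_ball_vol_n])

text \<open>The Riesz potential of a nonnegative function as an extended nonnegative integral, so
  that it has a value at every point and divergence shows as \<open>\<infinity>\<close>.\<close>

definition riesz_nn :: "('a \<Rightarrow> real) \<Rightarrow> 'a \<Rightarrow> ennreal" where
  "riesz_nn u x = (\<integral>\<^sup>+y. ennreal (u y * norm (x - y) powr (\<alpha> - n)) \<partial>lebesgue)"

text \<open>\<open>B\<close> controls balls of all centres and radii, \<open>E\<close> only large
  balls around \<open>x0\<close>. They are kept apart because vanishing at infinity makes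
  \<open>E\<close> small while \<open>B\<close> stays a power of the norm.\<close>

context
  fixes u :: "'a \<Rightarrow> real" and x0 :: 'a and r E B :: real
  assumes u [measurable]: "u \<in> borel_measurable lebesgue" and u0: "\<And>y. 0 \<le> u y"
    and lam_pos: "0 < lam" and r: "0 < r" and E: "0 \<le> E" and B: "0 \<le> B"
    and B_bound: "\<And>x t. 0 < t \<Longrightarrow>
      (\<integral>\<^sup>+y. ennreal (u y powr p) * indicator (ball x t) y \<partial>lebesgue) \<le> ennreal (B * t powr lam)"
    and E_bound: "\<And>t. 2 * r \<le> t \<Longrightarrow>
      (\<integral>\<^sup>+y. ennreal (u y powr p) * indicator (ball x0 t) y \<partial>lebesgue) \<le> ennreal (E * t powr lam)"
begin

section \<open>The near part: integration over \<open>ball x0 (2 * r)\<close>\<close>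

abbreviation (input) "\<beta> \<equiv> near_ratio * lam"
abbreviation (input) "\<gamma> \<equiv> near_ratio * n"
abbreviation (input) "vol \<equiv> unit_ball_vol n"

lemma near_pow_less: "0 < \<beta>" "\<beta> < lam" "0 < \<gamma>" "\<gamma> < n"
  using near_ratio[OF lam_pos] lam_pos n_pos by auto

text \<open>The integral over \<open>y\<close> of the base of the second factor in the overview's
  splitting, the only one to be integrated in \<open>x\<close> later.\<close>

definition "near_weight x = (\<integral>\<^sup>+y. ennreal (u y powr p * norm (x - y) powr (-\<gamma>)) * indicator (ball x0 (2 * r)) y \<partial>lebesgue)"

lemma near_weight_measurable [measurable]: "near_weight \<in> borel_measurable lebesgue"
proof -
  interpret pair_sigma_finite "lebesgue :: 'a measure" "lebesgue :: 'a measure"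
    by (rule pair_sigma_finite_lebesgue)
  show ?thesis unfolding near_weight_def by measurable
qed

lemma nn_integral_near_power:
  fixes x :: 'a
  assumes "0 < R"
  shows "(\<integral>\<^sup>+y. ennreal (norm (x - y) powr (-\<gamma>)) * indicator (ball x R) y \<partial>lebesgue)
    \<le> ennreal (dyadic_const \<gamma> (n - \<gamma>) * vol * R powr (n - \<gamma>))"
  using nn_integral_power_weight_near[of "\<lambda>_. 1" R \<gamma> n vol x] assms near_pow_less
    nn_integral_ball_one[of _ x] less_imp_le[OF unit_ball_vol_n]
  by (simp only: mult_1 zero_le_one borel_measurable_const order_refl)

text \<open>By Tonelli the kernel is integrated in \<open>x\<close> first, which gives a bound
  independent of \<open>y\<close>. What remains is the mass of \<open>u powr p\<close> on
  \<open>ball x0 (2 * r)\<close>, to which \<open>E_bound\<close> applies at its smallest radius;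
  hence the bound is linear in \<open>E\<close>.\<close>

lemma nn_integral_near_weight:
  "(\<integral>\<^sup>+x. near_weight x * indicator (ball x0 r) x \<partial>lebesgue)
    \<le> ennreal (dyadic_const \<gamma> (n - \<gamma>) * vol * (3 * r) powr (n - \<gamma>) * (E * (2 * r) powr lam))"
proof -
  interpret pair_sigma_finite "lebesgue :: 'a measure" "lebesgue :: 'a measure"
    by (rule pair_sigma_finite_lebesgue)
  let ?C = "dyadic_const \<gamma> (n - \<gamma>) * vol * (3 * r) powr (n - \<gamma>)"
  have C: "0 \<le> ?C"
    using near_pow_less dyadic_const_pos[of "n - \<gamma>" \<gamma>] by (simp add: less_imp_le[OF unit_ball_vol_n])
  have "(\<integral>\<^sup>+x. near_weight x * indicator (ball x0 r) x \<partial>lebesgue)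
      = (\<integral>\<^sup>+x. (\<integral>\<^sup>+y. ennreal (u y powr p * norm (x - y) powr (-\<gamma>)) * indicator (ball x0 (2 * r)) y
          * indicator (ball x0 r) x \<partial>lebesgue) \<partial>lebesgue)"
    unfolding near_weight_def by (subst nn_integral_multc) auto
  also have "\<dots> = (\<integral>\<^sup>+y. (\<integral>\<^sup>+x. ennreal (u y powr p * norm (x - y) powr (-\<gamma>)) * indicator (ball x0 (2 * r)) y
          * indicator (ball x0 r) x \<partial>lebesgue) \<partial>lebesgue)"
    by (rule Fubini'[symmetric]) measurable
  also have "\<dots> = (\<integral>\<^sup>+y. (ennreal (u y powr p) * indicator (ball x0 (2 * r)) y) * (\<integral>\<^sup>+x. ennreal (norm (y - x) powr (-\<gamma>))
          * indicator (ball x0 r) x \<partial>lebesgue) \<partial>lebesgue)"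
    by (subst nn_integral_cmult[symmetric])
      (auto intro!: nn_integral_cong simp: ennreal_mult norm_minus_commute mult_ac)
  also have "\<dots> \<le> (\<integral>\<^sup>+y. (ennreal (u y powr p) * indicator (ball x0 (2 * r)) y) * ennreal ?C \<partial>lebesgue)"
  proof (rule nn_integral_mono)
    fix y
    have "(\<integral>\<^sup>+x. ennreal (norm (y - x) powr (-\<gamma>)) * indicator (ball x0 r) x \<partial>lebesgue) \<le> ennreal ?C"
      if "y \<in> ball x0 (2 * r)"
    proof -
      \<comment> \<open>Enlarging the domain to a ball around \<open>y\<close> centres it at the
        singularity, as \<open>nn_integral_near_power\<close> requires.\<close>
      have "ball x0 r \<subseteq> ball y (3 * r)"
      proof
        fix z assume "z \<in> ball x0 r"
        then show "z \<in> ball y (3 * r)"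
          using that dist_triangle[of y z x0] by (simp add: dist_commute)
      qed
      then have "(\<integral>\<^sup>+x. ennreal (norm (y - x) powr (-\<gamma>)) * indicator (ball x0 r) x \<partial>lebesgue)
        \<le> (\<integral>\<^sup>+x. ennreal (norm (y - x) powr (-\<gamma>)) * indicator (ball y (3 * r)) x \<partial>lebesgue)"
        by (intro nn_integral_mono mult_left_mono) (auto simp: indicator_def)
      also have "\<dots> \<le> ennreal ?C" using r by (intro nn_integral_near_power) auto
      finally show ?thesis .
    qed
    then show "ennreal (u y powr p) * indicator (ball x0 (2 * r)) y
        * (\<integral>\<^sup>+x. ennreal (norm (y - x) powr (-\<gamma>)) * indicator (ball x0 r) x \<partial>lebesgue)
      \<le> (ennreal (u y powr p) * indicator (ball x0 (2 * r)) y) * ennreal ?C"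
      by (cases "y \<in> ball x0 (2 * r)") (auto intro!: mult_left_mono)
  qed
  also have "\<dots> = (\<integral>\<^sup>+y. ennreal (u y powr p) * indicator (ball x0 (2 * r)) y \<partial>lebesgue) * ennreal ?C"
    by (subst nn_integral_multc) auto
  also have "\<dots> \<le> ennreal (E * (2 * r) powr lam) * ennreal ?C"
    using r by (intro mult_right_mono E_bound) auto
  also have "\<dots> = ennreal (?C * (E * (2 * r) powr lam))"
    using ennreal_mult'[OF C, of "E * (2 * r) powr lam"] by (simp only: mult.commute)
  finally show ?thesis .
qed

text \<open>The three-factor Hoelder inequality of the overview, as two applications of the
  two-factor one: first to \<open>?a\<close> and \<open>?b\<close>, then to the result and
  \<open>?c\<close>. The weight in \<open>?a\<close> is centred at \<open>x\<close> and sees small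
  balls, so it is bounded through \<open>B\<close>; \<open>E\<close> will enter only through
  \<open>g\<close>.\<close>

lemma near_part:
  assumes x: "x \<in> ball x0 r" and g: "near_weight x \<le> ennreal g" "0 \<le> g"
  shows "(\<integral>\<^sup>+y. ennreal (u y * norm (x - y) powr (\<alpha> - n)) * indicator (ball x0 (2 * r)) y \<partial>lebesgue)
    \<le> ennreal ((dyadic_const \<beta> (lam - \<beta>) * B * (3 * r) powr (lam - \<beta>)) powr (\<alpha> / n)
        * (dyadic_const \<gamma> (n - \<gamma>) * vol * (3 * r) powr (n - \<gamma>)) powr (1 - 1 / p) * g powr (1 / q))"
proof -
  let ?I = "indicator (ball x0 (2 * r)) :: 'a \<Rightarrow> real"
  let ?a = "\<lambda>y. u y powr p * norm (x - y) powr (-\<beta>) * ?I y"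
  let ?b = "\<lambda>y. u y powr p * norm (x - y) powr (-\<gamma>) * ?I y"
  let ?c = "\<lambda>y. norm (x - y) powr (-\<gamma>) * ?I y"
  let ?A = "dyadic_const \<beta> (lam - \<beta>) * B * (3 * r) powr (lam - \<beta>)"
  let ?C = "dyadic_const \<gamma> (n - \<gamma>) * vol * (3 * r) powr (n - \<gamma>)"
  \<comment> \<open>Chosen so that the outer exponent \<open>1 / p\<close> turns
    \<open>?\<sigma>\<close> into \<open>\<alpha> / n\<close> and \<open>1 - ?\<sigma>\<close> into
    \<open>1 / q\<close>.\<close>
  let ?\<sigma> = "\<alpha> * p / n"
  have \<sigma>: "0 < ?\<sigma>" "?\<sigma> < 1" "?\<sigma> / p = \<alpha> / n" "(1 - ?\<sigma>) / p = 1 / q"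
    using \<alpha>_pos \<alpha>_less p_gt_1 p_less by (simp_all add: q_eq field_simps)
  have A: "0 \<le> ?A" "0 \<le> ?C"
    using near_pow_less dyadic_const_pos[of "n - \<gamma>" \<gamma>] dyadic_const_pos[of "lam - \<beta>" \<beta>] B
    by (simp_all add: less_imp_le[OF unit_ball_vol_n])
  have sub: "ball x0 (2 * r) \<subseteq> ball x (3 * r)"
  proof
    fix z assume "z \<in> ball x0 (2 * r)"
    then show "z \<in> ball x (3 * r)"
      using x dist_triangle[of x z x0] by (simp add: dist_commute)
  qed
  have [simp]: "ennreal (?I y) = indicator (ball x0 (2 * r)) y" for y
    by (simp add: indicator_def)
  have ia: "(\<integral>\<^sup>+y. ennreal (?a y) \<partial>lebesgue) \<le> ennreal ?A"
  proof -
    have "(\<integral>\<^sup>+y. ennreal (?a y) \<partial>lebesgue)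
      \<le> (\<integral>\<^sup>+y. ennreal (u y powr p * norm (x - y) powr (-\<beta>)) * indicator (ball x (3 * r)) y \<partial>lebesgue)"
      using sub by (intro nn_integral_mono) (auto simp: indicator_def)
    also have "\<dots> \<le> ennreal ?A"
      using near_pow_less r B B_bound by (intro nn_integral_power_weight_near) auto
    finally show ?thesis .
  qed
  have ib: "(\<integral>\<^sup>+y. ennreal (?b y) \<partial>lebesgue) \<le> ennreal g"
    using g by (simp add: near_weight_def ennreal_mult u0)
  have ic: "(\<integral>\<^sup>+y. ennreal (?c y) \<partial>lebesgue) \<le> ennreal ?C"
  proof -
    have "(\<integral>\<^sup>+y. ennreal (?c y) \<partial>lebesgue)
      \<le> (\<integral>\<^sup>+y. ennreal (norm (x - y) powr (-\<gamma>)) * indicator (ball x (3 * r)) y \<partial>lebesgue)"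
      using sub by (intro nn_integral_mono) (auto simp: indicator_def)
    also have "\<dots> \<le> ennreal ?C" using r by (intro nn_integral_near_power) auto
    finally show ?thesis .
  qed
  have iab: "(\<integral>\<^sup>+y. ennreal (?a y powr ?\<sigma> * ?b y powr (1 - ?\<sigma>)) \<partial>lebesgue)
      \<le> ennreal (?A powr ?\<sigma> * g powr (1 - ?\<sigma>))"
    by (rule nn_integral_Holder) (use ia ib A g u0 \<sigma> in auto)
  have "(\<integral>\<^sup>+y. ennreal (u y * norm (x - y) powr (\<alpha> - n)) * indicator (ball x0 (2 * r)) y \<partial>lebesgue)
      = (\<integral>\<^sup>+y. ennreal ((?a y powr ?\<sigma> * ?b y powr (1 - ?\<sigma>)) powr (1 / p) * ?c y powr (1 - 1 / p)) \<partial>lebesgue)"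
  proof (rule nn_integral_cong)
    fix y
    show "ennreal (u y * norm (x - y) powr (\<alpha> - n)) * indicator (ball x0 (2 * r)) y
      = ennreal ((?a y powr ?\<sigma> * ?b y powr (1 - ?\<sigma>)) powr (1 / p) * ?c y powr (1 - 1 / p))"
    \<comment> \<open>In the excluded cases both sides are 0, again by
      \<open>0 powr a = 0\<close>.\<close>
    proof (cases "y \<in> ball x0 (2 * r) \<and> y \<noteq> x \<and> u y \<noteq> 0")
      case True
      then have pos: "0 < u y" "0 < norm (x - y)" using u0[of y] by auto
      let ?N = "norm (x - y)"
      \<comment> \<open>As \<open>1 / q + 1 - 1 / p = 1 - \<alpha> / n\<close>, the last two terms
        add up to \<open>near_ratio * (n - \<alpha>)\<close>.\<close>
      have e: "near_ratio * lam * (\<alpha> / n) + near_ratio * n * (1 / q) + near_ratio * n * (1 - 1 / p) = n - \<alpha>"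
      proof -
        have "near_ratio * lam * (\<alpha> / n) + near_ratio * n * (1 / q) + near_ratio * n * (1 - 1 / p)
          = near_ratio * (n - \<alpha> + lam * (\<alpha> / n))"
          using \<alpha>_pos \<alpha>_less by (simp add: q_eq algebra_simps)
        then show ?thesis using near_ratio(3)[OF lam_pos] by simp
      qed
      have "(?a y powr ?\<sigma> * ?b y powr (1 - ?\<sigma>)) powr (1 / p) * ?c y powr (1 - 1 / p)
          = (u y powr (p * ?\<sigma> / p) * u y powr (p * (1 - ?\<sigma>) / p))
            * (?N powr (- (\<beta> * (?\<sigma> / p))) * ?N powr (- (\<gamma> * ((1 - ?\<sigma>) / p))) * ?N powr (- (\<gamma> * (1 - 1 / p))))"
        using True pos by (simp add: powr_mult powr_powr mult_ac)
      also have "\<dots> = u y powr (p * ?\<sigma> / p + p * (1 - ?\<sigma>) / p)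
            * ?N powr (- (\<beta> * (?\<sigma> / p) + \<gamma> * ((1 - ?\<sigma>) / p) + \<gamma> * (1 - 1 / p)))"
        by (simp only: powr_add[symmetric] minus_add_distrib)
      also have "p * ?\<sigma> / p + p * (1 - ?\<sigma>) / p = 1"
        using p_gt_1 by simp
      also have "\<beta> * (?\<sigma> / p) + \<gamma> * ((1 - ?\<sigma>) / p) + \<gamma> * (1 - 1 / p) = n - \<alpha>"
        unfolding \<sigma>(3,4) by (rule e)
      finally show ?thesis using True pos by simp
    qed auto
  qed
  also have "\<dots> \<le> ennreal ((?A powr ?\<sigma> * g powr (1 - ?\<sigma>)) powr (1 / p) * ?C powr (1 - 1 / p))"
    by (rule nn_integral_Holder) (use iab ic A g u0 \<sigma> p_gt_1 in auto)
  also have "(?A powr ?\<sigma> * g powr (1 - ?\<sigma>)) powr (1 / p) = ?A powr (?\<sigma> / p) * g powr ((1 - ?\<sigma>) / p)"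
    using A g by (simp add: powr_mult powr_powr)
  finally show ?thesis unfolding \<sigma>(3,4) by (simp only: mult_ac)
qed

section \<open>The far part: integration outside \<open>ball x0 (2 * r)\<close>\<close>

abbreviation (input) "\<beta>' \<equiv> far_ratio * lam"
abbreviation (input) "\<gamma>' \<equiv> far_ratio * n"

lemma far_pow_less: "lam < \<beta>'" "n < \<gamma>'"
  using far_ratio(1) lam_pos n_pos by auto

text \<open>Outside \<open>ball x0 (2 * r)\<close> one has
  \<open>norm (x - y) \<ge> norm (x0 - y) / 2\<close>, so the kernel can be centred at
  \<open>x0\<close> at the cost of \<open>2 powr (n - \<alpha>)\<close>, and the bound no longer
  depends on \<open>x\<close>. Only radii from \<open>2 * r\<close> on occur, so \<open>E\<close>
  suffices.\<close>

lemma far_part: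
  assumes x: "x \<in> ball x0 r"
  shows "(\<integral>\<^sup>+y. ennreal (u y * norm (x - y) powr (\<alpha> - n)) * indicator (- ball x0 (2 * r)) y \<partial>lebesgue)
    \<le> ennreal (2 powr (n - \<alpha>) * ((dyadic_const lam (\<beta>' - lam) * E * (2 * r) powr (lam - \<beta>')) powr (1 / p)
        * (dyadic_const n (\<gamma>' - n) * vol * (2 * r) powr (n - \<gamma>')) powr (1 - 1 / p)))"
proof -
  let ?I = "indicator (- ball x0 (2 * r)) :: 'a \<Rightarrow> real"
  let ?a = "\<lambda>y. u y powr p * norm (x0 - y) powr (-\<beta>') * ?I y"
  let ?c = "\<lambda>y. norm (x0 - y) powr (-\<gamma>') * ?I y"
  let ?A = "dyadic_const lam (\<beta>' - lam) * E * (2 * r) powr (lam - \<beta>')"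
  let ?C = "dyadic_const n (\<gamma>' - n) * vol * (2 * r) powr (n - \<gamma>')"
  have A: "0 \<le> ?A" "0 \<le> ?C"
    using far_pow_less dyadic_const_pos[of "\<gamma>' - n" n] dyadic_const_pos[of "\<beta>' - lam" lam] E
    by (simp_all add: less_imp_le[OF unit_ball_vol_n])
  have [simp]: "ennreal (?I y) = indicator (- ball x0 (2 * r)) y" for y
    by (simp add: indicator_def)
  have ia: "(\<integral>\<^sup>+y. ennreal (?a y) \<partial>lebesgue) \<le> ennreal ?A"
    using nn_integral_power_weight_far[of "\<lambda>y. u y powr p" "2 * r" lam \<beta>' E x0]
      far_pow_less r E lam_pos E_bound u0 by (simp add: ennreal_mult)
  have ic: "(\<integral>\<^sup>+y. ennreal (?c y) \<partial>lebesgue) \<le> ennreal ?C"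
    using nn_integral_power_weight_far[of "\<lambda>y. 1" "2 * r" n \<gamma>' vol x0]
      far_pow_less r n_pos nn_integral_ball_one[of _ x0] less_imp_le[OF unit_ball_vol_n]
    by (simp add: ennreal_mult del: nn_integral_indicator)
  have "(\<integral>\<^sup>+y. ennreal (u y * norm (x - y) powr (\<alpha> - n)) * indicator (- ball x0 (2 * r)) y \<partial>lebesgue)
      \<le> (\<integral>\<^sup>+y. ennreal (2 powr (n - \<alpha>)) * ennreal (?a y powr (1 / p) * ?c y powr (1 - 1 / p)) \<partial>lebesgue)"
  proof (rule nn_integral_mono)
    fix y
    show "ennreal (u y * norm (x - y) powr (\<alpha> - n)) * indicator (- ball x0 (2 * r)) y
      \<le> ennreal (2 powr (n - \<alpha>)) * ennreal (?a y powr (1 / p) * ?c y powr (1 - 1 / p))"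
    proof (cases "y \<in> - ball x0 (2 * r)")
      case True
      let ?N = "norm (x0 - y)"
      have N: "2 * r \<le> ?N" "?N / 2 \<le> norm (x - y)"
        using True x dist_triangle[of x0 y x] by (auto simp: dist_norm norm_minus_commute)
      have "norm (x - y) powr (\<alpha> - n) \<le> (?N / 2) powr (\<alpha> - n)"
        using N r \<alpha>_less by (intro powr_mono2') auto
      also have "\<dots> = 2 powr (n - \<alpha>) * ?N powr (\<alpha> - n)"
        using N r by (simp add: powr_divide powr_diff)
      finally have 1: "u y * norm (x - y) powr (\<alpha> - n) \<le> u y * (2 powr (n - \<alpha>) * ?N powr (\<alpha> - n))"
        using u0 by (intro mult_left_mono) auto
      have e: "\<beta>' * (1 / p) + \<gamma>' * (1 - 1 / p) = n - \<alpha>"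
        using far_ratio(2) by (simp add: algebra_simps)
      have "?a y powr (1 / p) * ?c y powr (1 - 1 / p)
        = u y powr (p * (1 / p)) * (?N powr (- (\<beta>' * (1 / p))) * ?N powr (- (\<gamma>' * (1 - 1 / p))))"
        using True N r u0[of y] by (simp add: powr_mult powr_powr)
      also have "\<dots> = u y powr (p * (1 / p)) * ?N powr (- (\<beta>' * (1 / p) + \<gamma>' * (1 - 1 / p)))"
        by (simp only: powr_add[symmetric] minus_add_distrib)
      also have "\<dots> = u y * ?N powr (\<alpha> - n)"
        unfolding e using p_gt_1 u0[of y] by simp
      finally have "2 powr (n - \<alpha>) * (?a y powr (1 / p) * ?c y powr (1 - 1 / p))
        = u y * (2 powr (n - \<alpha>) * ?N powr (\<alpha> - n))" by simp
      then show ?thesis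
        using 1 True by (simp add: ennreal_mult'[symmetric] ennreal_leI mult.left_commute)
    qed auto
  qed
  also have "\<dots> = ennreal (2 powr (n - \<alpha>)) * (\<integral>\<^sup>+y. ennreal (?a y powr (1 / p) * ?c y powr (1 - 1 / p)) \<partial>lebesgue)"
    by (subst nn_integral_cmult) auto
  also have "\<dots> \<le> ennreal (2 powr (n - \<alpha>)) * ennreal (?A powr (1 / p) * ?C powr (1 - 1 / p))"
    by (intro mult_left_mono nn_integral_Holder) (use ia ic A u0 p_gt_1 in auto)
  finally show ?thesis by (simp add: ennreal_mult)
qed

text \<open>The \<open>q\<close>-th power of the coefficient in \<open>near_part\<close> times the
  bound for the integral of \<open>near_weight\<close>. The power of \<open>B\<close> is
  \<open>q * \<alpha> / n = q / p - 1\<close>, and \<open>E\<close> stays linear.\<close>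

lemma near_scaling:
  "((dyadic_const \<beta> (lam - \<beta>) * B * (3 * r) powr (lam - \<beta>)) powr (\<alpha> / n)
      * (dyadic_const \<gamma> (n - \<gamma>) * vol * (3 * r) powr (n - \<gamma>)) powr (1 - 1 / p)) powr q
      * (dyadic_const \<gamma> (n - \<gamma>) * vol * (3 * r) powr (n - \<gamma>) * (E * (2 * r) powr lam))
    = near_const * (B powr (q / p - 1) * E) * r powr \<mu>"
proof -
  let ?kA = "dyadic_const \<beta> (lam - \<beta>)" and ?kC = "dyadic_const \<gamma> (n - \<gamma>) * vol"
  have a: "\<alpha> / n * q = q / p - 1" using alpha_alt by simp
  have b: "(1 - 1 / p) * q = q - q / p" by (simp add: algebra_simps)
  have "((?kA * B * (3 * r) powr (lam - \<beta>)) powr (\<alpha> / n) * (?kC * (3 * r) powr (n - \<gamma>)) powr (1 - 1 / p)) powr q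
    = (?kA * B * (3 * r) powr (lam - \<beta>)) powr (q / p - 1) * (?kC * (3 * r) powr (n - \<gamma>)) powr (q - q / p)"
    by (simp only: powr_mult powr_powr mult.assoc a b)
  also have "(?kA * B * (3 * r) powr (lam - \<beta>)) powr (q / p - 1)
    = (?kA * 3 powr (lam - \<beta>)) powr (q / p - 1) * B powr (q / p - 1) * r powr ((lam - \<beta>) * (q / p - 1))"
    using r by (simp add: powr_mult powr_powr)
  also have "(?kC * (3 * r) powr (n - \<gamma>)) powr (q - q / p)
    = (?kC * 3 powr (n - \<gamma>)) powr (q - q / p) * r powr ((n - \<gamma>) * (q - q / p))"
    using r by (simp add: powr_mult powr_powr)
  finally have "((?kA * B * (3 * r) powr (lam - \<beta>)) powr (\<alpha> / n) * (?kC * (3 * r) powr (n - \<gamma>)) powr (1 - 1 / p)) powr q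
    = (?kA * 3 powr (lam - \<beta>)) powr (q / p - 1) * B powr (q / p - 1) * r powr ((lam - \<beta>) * (q / p - 1))
      * ((?kC * 3 powr (n - \<gamma>)) powr (q - q / p) * r powr ((n - \<gamma>) * (q - q / p)))" .
  moreover have "?kC * (3 * r) powr (n - \<gamma>) * (E * (2 * r) powr lam)
    = (?kC * 3 powr (n - \<gamma>) * 2 powr lam) * E * (r powr (n - \<gamma>) * r powr lam)"
    using r by (simp add: powr_mult)
  ultimately have "((?kA * B * (3 * r) powr (lam - \<beta>)) powr (\<alpha> / n) * (?kC * (3 * r) powr (n - \<gamma>)) powr (1 - 1 / p)) powr q
      * (?kC * (3 * r) powr (n - \<gamma>) * (E * (2 * r) powr lam))
    = (?kA * 3 powr (lam - \<beta>)) powr (q / p - 1) * B powr (q / p - 1) * r powr ((lam - \<beta>) * (q / p - 1))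
      * ((?kC * 3 powr (n - \<gamma>)) powr (q - q / p) * r powr ((n - \<gamma>) * (q - q / p)))
      * ((?kC * 3 powr (n - \<gamma>) * 2 powr lam) * E * (r powr (n - \<gamma>) * r powr lam))"
    by (rule arg_cong2[where f = "(*)"])
  also have "\<dots>
    = near_const * (B powr (q / p - 1) * E)
      * (r powr ((lam - \<beta>) * (q / p - 1)) * r powr ((n - \<gamma>) * (q - q / p)) * r powr (n - \<gamma>) * r powr lam)"
    unfolding near_const_def by (simp only: mult_ac)
  also have "r powr ((lam - \<beta>) * (q / p - 1)) * r powr ((n - \<gamma>) * (q - q / p)) * r powr (n - \<gamma>) * r powr lam
    = r powr ((lam - \<beta>) * (q / p - 1) + (n - \<gamma>) * (q - q / p) + (n - \<gamma>) + lam)"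
    by (simp only: powr_add)
  \<comment> \<open>The first three terms equal
    \<open>(1 - near_ratio) * q * (n - \<alpha> + lam * (\<alpha> / n))\<close>. By the choice of
    \<open>near_ratio\<close> this is \<open>q * lam * \<alpha> / n = lam * (q / p - 1)\<close>, and
    adding \<open>lam\<close> gives \<open>\<mu>\<close>.\<close>
  also have "(lam - \<beta>) * (q / p - 1) + (n - \<gamma>) * (q - q / p) + (n - \<gamma>) + lam = \<mu>"
  proof -
    have gen: "(1 - t) * (c * X) = c * X - c * (t * X)" for t c X :: real
      by (simp add: algebra_simps)
    have "(lam - \<beta>) * (q / p - 1) + (n - \<gamma>) * (q - q / p) + (n - \<gamma>)
      = (1 - near_ratio) * (lam * (q / p - 1) + n * q - (n * (q / p) - n))"
      by (simp add: algebra_simps)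
    also have "n * (q / p) - n = q * \<alpha>" using n_div_q by simp
    also have "lam * (q / p - 1) + n * q - q * \<alpha> = q * (n - \<alpha> + lam * (\<alpha> / n))"
      unfolding a[symmetric] by (simp add: algebra_simps)
    also have "(1 - near_ratio) * (q * (n - \<alpha> + lam * (\<alpha> / n)))
      = q * (n - \<alpha> + lam * (\<alpha> / n)) - q * (near_ratio * (n - \<alpha> + lam * (\<alpha> / n)))"
      by (rule gen)
    also have "\<dots> = lam * (\<alpha> / n * q)"
      unfolding near_ratio(3)[OF lam_pos] by (simp add: algebra_simps)
    finally show ?thesis unfolding a mu_alt by (simp add: algebra_simps)
  qed
  finally show ?thesis .
qed

text \<open>The \<open>q\<close>-th power of the bound in \<open>far_part\<close>, constant in
  \<open>x\<close>, times the volume of \<open>ball x0 r\<close>.\<close>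

lemma far_scaling:
  "(2 powr (n - \<alpha>) * ((dyadic_const lam (\<beta>' - lam) * E * (2 * r) powr (lam - \<beta>')) powr (1 / p)
      * (dyadic_const n (\<gamma>' - n) * vol * (2 * r) powr (n - \<gamma>')) powr (1 - 1 / p))) powr q * (vol * r powr n)
    = far_const * E powr (q / p) * r powr \<mu>"
proof -
  let ?kA = "dyadic_const lam (\<beta>' - lam)" and ?kC = "dyadic_const n (\<gamma>' - n) * vol"
  have a: "1 / p * q = q / p" by simp
  have b: "(1 - 1 / p) * q = q - q / p" by (simp add: algebra_simps)
  have "(2 powr (n - \<alpha>) * ((?kA * E * (2 * r) powr (lam - \<beta>')) powr (1 / p)
      * (?kC * (2 * r) powr (n - \<gamma>')) powr (1 - 1 / p))) powr q
    = 2 powr ((n - \<alpha>) * q) * ((?kA * E * (2 * r) powr (lam - \<beta>')) powr (q / p)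
      * (?kC * (2 * r) powr (n - \<gamma>')) powr (q - q / p))"
    by (simp only: powr_mult powr_powr mult.assoc a b)
  also have "(?kA * E * (2 * r) powr (lam - \<beta>')) powr (q / p)
    = (?kA * 2 powr (lam - \<beta>')) powr (q / p) * E powr (q / p) * r powr ((lam - \<beta>') * (q / p))"
    using r by (simp add: powr_mult powr_powr)
  also have "(?kC * (2 * r) powr (n - \<gamma>')) powr (q - q / p)
    = (?kC * 2 powr (n - \<gamma>')) powr (q - q / p) * r powr ((n - \<gamma>') * (q - q / p))"
    using r by (simp add: powr_mult powr_powr)
  finally have "(2 powr (n - \<alpha>) * ((?kA * E * (2 * r) powr (lam - \<beta>')) powr (1 / p)
      * (?kC * (2 * r) powr (n - \<gamma>')) powr (1 - 1 / p))) powr q * (vol * r powr n)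
    = 2 powr ((n - \<alpha>) * q) * ((?kA * 2 powr (lam - \<beta>')) powr (q / p) * E powr (q / p) * r powr ((lam - \<beta>') * (q / p))
      * ((?kC * 2 powr (n - \<gamma>')) powr (q - q / p) * r powr ((n - \<gamma>') * (q - q / p)))) * (vol * r powr n)"
    by (rule arg_cong)
  also have "\<dots>
    = far_const * E powr (q / p)
      * (r powr ((lam - \<beta>') * (q / p)) * r powr ((n - \<gamma>') * (q - q / p)) * r powr n)"
    unfolding far_const_def by (simp only: mult_ac)
  also have "r powr ((lam - \<beta>') * (q / p)) * r powr ((n - \<gamma>') * (q - q / p)) * r powr n
    = r powr ((lam - \<beta>') * (q / p) + (n - \<gamma>') * (q - q / p) + n)"
    by (simp only: powr_add)
  \<comment> \<open>The first two terms are
    \<open>q * (1 - far_ratio) * (lam / p + n * (1 - 1 / p))\<close>. The choice of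
    \<open>far_ratio\<close> replaces its product with the last factor by
    \<open>n - \<alpha>\<close>, and \<open>n_div_q\<close> then cancels the remaining
    \<open>n\<close>.\<close>
  also have "(lam - \<beta>') * (q / p) + (n - \<gamma>') * (q - q / p) + n = \<mu>"
  proof -
    have gen: "(a - s * a) * (c * P) + (b - s * b) * (c - c * P) = c * (a * P + b * (1 - P)) - c * (s * (a * P + b * (1 - P)))"
      "c * (a * P + b * (1 - P)) - c * (b - d) = a * (c * P) - (b * (c * P) - c * d)"
      for a b c d s P :: real
      by (simp_all add: algebra_simps)
    have "(lam - \<beta>') * (q / p) + (n - \<gamma>') * (q - q / p)
      = q * (lam / p + n * (1 - 1 / p)) - q * (far_ratio * (lam / p + n * (1 - 1 / p)))"
      using gen(1)[of lam far_ratio q "1 / p" n] by simp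
    also have "\<dots> = lam * (q / p) - (n * (q / p) - q * \<alpha>)"
      unfolding far_ratio(2) using gen(2)[of q lam "1 / p" n \<alpha>] by simp
    finally show ?thesis unfolding n_div_q mu_alt by simp
  qed
  finally show ?thesis .
qed

section \<open>The near and the far part combined\<close>

abbreviation (input) "U \<equiv> (dyadic_const \<beta> (lam - \<beta>) * B * (3 * r) powr (lam - \<beta>)) powr (\<alpha> / n)
      * (dyadic_const \<gamma> (n - \<gamma>) * vol * (3 * r) powr (n - \<gamma>)) powr (1 - 1 / p)"
abbreviation (input) "V \<equiv> 2 powr (n - \<alpha>) * ((dyadic_const lam (\<beta>' - lam) * E * (2 * r) powr (lam - \<beta>')) powr (1 / p)
      * (dyadic_const n (\<gamma>' - n) * vol * (2 * r) powr (n - \<gamma>')) powr (1 - 1 / p))"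

lemma riesz_nn_le_near_far:
  assumes x: "x \<in> ball x0 r" and g: "near_weight x = ennreal g" "0 \<le> g"
  shows "riesz_nn u x \<le> ennreal (U * g powr (1 / q) + V)"
proof -
  have "riesz_nn u x
    = (\<integral>\<^sup>+y. ennreal (u y * norm (x - y) powr (\<alpha> - n)) * indicator (ball x0 (2 * r)) y
        + ennreal (u y * norm (x - y) powr (\<alpha> - n)) * indicator (- ball x0 (2 * r)) y \<partial>lebesgue)"
    unfolding riesz_nn_def by (intro nn_integral_cong) (simp add: indicator_def)
  also have "\<dots> = (\<integral>\<^sup>+y. ennreal (u y * norm (x - y) powr (\<alpha> - n)) * indicator (ball x0 (2 * r)) y \<partial>lebesgue)
        + (\<integral>\<^sup>+y. ennreal (u y * norm (x - y) powr (\<alpha> - n)) * indicator (- ball x0 (2 * r)) y \<partial>lebesgue)"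
    by (intro nn_integral_add) measurable
  also have "\<dots> \<le> ennreal (U * g powr (1 / q)) + ennreal V"
    using near_part[OF x eq_refl[OF g(1)] g(2)] far_part[OF x] by (rule add_mono)
  also have "\<dots> = ennreal (U * g powr (1 / q) + V)"
    by (intro ennreal_plus[symmetric]) auto
  finally show ?thesis .
qed

lemma AE_near_weight_finite: "AE x in lebesgue. x \<in> ball x0 r \<longrightarrow> near_weight x \<noteq> \<infinity>"
proof -
  have "AE x in lebesgue. near_weight x * indicator (ball x0 r) x \<noteq> \<infinity>"
    using nn_integral_near_weight by (intro nn_integral_noteq_infinite) (auto simp: top_unique)
  then show ?thesis by eventually_elim auto
qed

lemma AE_riesz_nn_finite_ball: "AE x in lebesgue. x \<in> ball x0 r \<longrightarrow> riesz_nn u x < \<infinity>"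
  using AE_near_weight_finite
proof eventually_elim
  case (elim x)
  show ?case
  proof
    assume x: "x \<in> ball x0 r"
    with elim have "near_weight x = ennreal (enn2real (near_weight x))"
      by (simp add: less_top)
    from le_less_trans[OF riesz_nn_le_near_far[OF x this]] show "riesz_nn u x < \<infinity>"
      by simp
  qed
qed

text \<open>The \<open>q\<close>-th power of \<open>U * g powr (1 / q)\<close> is linear in
  \<open>g\<close>, so \<open>nn_integral_near_weight\<close> applies, while \<open>V\<close>
  contributes a multiple of the volume. In the far term \<open>E \<le> B\<close> trades all but one
  power of \<open>E\<close> for powers of \<open>B\<close>, which leaves a bound linear in
  \<open>E\<close>. Since \<open>enn2real \<infinity> = 0\<close>, the estimate gains its meaning
  from \<open>AE_riesz_nn_finite_ball\<close>.\<close>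

lemma nn_integral_riesz_nn_ball:
  assumes EB: "E \<le> B"
  shows "(\<integral>\<^sup>+x. ennreal (enn2real (riesz_nn u x) powr q) * indicator (ball x0 r) x \<partial>lebesgue)
    \<le> ennreal (2 powr q * (near_const + far_const) * (B powr (q / p - 1) * E) * r powr \<mu>)"
proof -
  have "(\<integral>\<^sup>+x. ennreal (enn2real (riesz_nn u x) powr q) * indicator (ball x0 r) x \<partial>lebesgue)
    \<le> (\<integral>\<^sup>+x. ennreal (2 powr q * U powr q) * (near_weight x * indicator (ball x0 r) x)
        + ennreal (2 powr q * V powr q) * indicator (ball x0 r) x \<partial>lebesgue)"
  proof (rule nn_integral_mono_AE)
    show "AE x in lebesgue. ennreal (enn2real (riesz_nn u x) powr q) * indicator (ball x0 r) x
      \<le> ennreal (2 powr q * U powr q) * (near_weight x * indicator (ball x0 r) x)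
        + ennreal (2 powr q * V powr q) * indicator (ball x0 r) x"
      using AE_near_weight_finite
    proof eventually_elim
      case (elim x)
      show ?case
      proof (cases "x \<in> ball x0 r")
        case True
        define g where "g = enn2real (near_weight x)"
        have g: "near_weight x = ennreal g" "0 \<le> g"
          using elim True by (simp_all add: g_def less_top)
        have U0: "0 \<le> U" and V0: "0 \<le> V" by auto
        have "enn2real (riesz_nn u x) \<le> U * g powr (1 / q) + V"
          using riesz_nn_le_near_far[OF True g] by (intro enn2real_leI) (auto intro!: add_nonneg_nonneg)
        then have "enn2real (riesz_nn u x) powr q \<le> (U * g powr (1 / q) + V) powr q"
          using q_pos by (intro powr_mono2) auto
        also have "\<dots> \<le> 2 powr q * ((U * g powr (1 / q)) powr q + V powr q)"
          using q_pos by (intro powr_add_le) auto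
        also have "\<dots> = 2 powr q * U powr q * g + 2 powr q * V powr q"
        proof -
          have "(U * g powr (1 / q)) powr q = U powr q * g"
            unfolding powr_mult[of U "g powr (1 / q)"] powr_powr using g q_pos by simp
          then show ?thesis by (simp only: distrib_left mult.assoc)
        qed
        finally have "ennreal (enn2real (riesz_nn u x) powr q)
          \<le> ennreal (2 powr q * U powr q * g + 2 powr q * V powr q)" by (rule ennreal_leI)
        also have "\<dots> = ennreal (2 powr q * U powr q * g) + ennreal (2 powr q * V powr q)"
          using g by (intro ennreal_plus) auto
        also have "ennreal (2 powr q * U powr q * g) = ennreal (2 powr q * U powr q) * ennreal g"
          using g by (intro ennreal_mult) auto
        finally show ?thesis using True g by simp
      qed simp
    qed
  qed
  also have "\<dots> = ennreal (2 powr q * U powr q) * (\<integral>\<^sup>+x. near_weight x * indicator (ball x0 r) x \<partial>lebesgue)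
      + ennreal (2 powr q * V powr q) * (\<integral>\<^sup>+x. ennreal 1 * indicator (ball x0 r) x \<partial>lebesgue)"
    by (subst nn_integral_add) (auto simp: nn_integral_cmult)
  also have "\<dots> \<le> ennreal (2 powr q * U powr q) * ennreal (dyadic_const \<gamma> (n - \<gamma>) * vol * (3 * r) powr (n - \<gamma>) * (E * (2 * r) powr lam))
      + ennreal (2 powr q * V powr q) * ennreal (vol * r powr n)"
    unfolding nn_integral_ball_one[OF r] by (intro add_mono mult_left_mono nn_integral_near_weight) auto
  also have "\<dots> = ennreal (2 powr q * (near_const * (B powr (q / p - 1) * E) * r powr \<mu>))
      + ennreal (2 powr q * (far_const * E powr (q / p) * r powr \<mu>))"
    unfolding near_scaling[symmetric] far_scaling[symmetric]
    by (simp only: ennreal_mult'[symmetric] mult_nonneg_nonneg powr_ge_zero mult.assoc)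
  also have "\<dots> = ennreal (2 powr q * (near_const * (B powr (q / p - 1) * E) * r powr \<mu>)
      + 2 powr q * (far_const * E powr (q / p) * r powr \<mu>))"
    using E near_const_nonneg[OF lam_pos] far_const_nonneg[OF lam_pos] by (intro ennreal_plus[symmetric]) auto
  also have "\<dots> \<le> ennreal (2 powr q * (near_const + far_const) * (B powr (q / p - 1) * E) * r powr \<mu>)"
  proof -
    have "E powr (q / p) = E powr (q / p - 1) * E"
    proof (cases "E = 0")
      case False
      then show ?thesis using E powr_add[of E "q / p - 1" 1] by simp
    qed simp
    also have "\<dots> \<le> B powr (q / p - 1) * E"
      using E EB q_gt_p p_gt_1 by (intro mult_right_mono powr_mono2) auto
    finally have "2 powr q * (far_const * E powr (q / p) * r powr \<mu>)
      \<le> 2 powr q * (far_const * (B powr (q / p - 1) * E) * r powr \<mu>)"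
      using far_const_nonneg[OF lam_pos] by (intro mult_left_mono mult_right_mono) auto
    then show ?thesis by (intro ennreal_leI) (simp add: algebra_simps)
  qed
  finally show ?thesis .
qed

end

end

section \<open>Morrey spaces\<close>

lemma set_integrable_ball_of_nn_integral:
  fixes g :: "'a::euclidean_space \<Rightarrow> real"
  assumes [measurable]: "g \<in> borel_measurable lebesgue" and "\<And>y. 0 \<le> g y"
    and "(\<integral>\<^sup>+y. ennreal (g y) * indicator (ball x r) y \<partial>lebesgue) < \<infinity>"
  shows "set_integrable lebesgue (ball x r) g"
  unfolding set_integrable_def
proof (rule integrableI_bounded)
  have "(\<integral>\<^sup>+y. ennreal (norm (indicat_real (ball x r) y *\<^sub>R g y)) \<partial>lebesgue)
      = (\<integral>\<^sup>+y. ennreal (g y) * indicator (ball x r) y \<partial>lebesgue)"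
    using assms by (intro nn_integral_cong) (simp add: indicator_def)
  then show "(\<integral>\<^sup>+y. ennreal (norm (indicat_real (ball x r) y *\<^sub>R g y)) \<partial>lebesgue) < \<infinity>"
    using assms by simp
qed measurable

lemma set_lebesgue_integral_ball_eq:
  fixes g :: "'a::euclidean_space \<Rightarrow> real"
  assumes [measurable]: "g \<in> borel_measurable lebesgue" and "\<And>y. 0 \<le> g y"
  shows "(LINT y:ball x r|lebesgue. g y)
    = enn2real (\<integral>\<^sup>+y. ennreal (g y) * indicator (ball x r) y \<partial>lebesgue)"
proof -
  have "(LINT y:ball x r|lebesgue. g y)
      = enn2real (\<integral>\<^sup>+y. ennreal (indicat_real (ball x r) y *\<^sub>R g y) \<partial>lebesgue)"
    unfolding set_lebesgue_integral_def using assms by (intro integral_eq_nn_integral) auto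
  also have "(\<integral>\<^sup>+y. ennreal (indicat_real (ball x r) y *\<^sub>R g y) \<partial>lebesgue)
      = (\<integral>\<^sup>+y. ennreal (g y) * indicator (ball x r) y \<partial>lebesgue)"
    by (intro nn_integral_cong) (simp add: indicator_def)
  finally show ?thesis .
qed

lemma morrey_modular_nonneg: "0 \<le> morrey_modular p lam f x r"
  unfolding morrey_modular_def set_lebesgue_integral_def
  by (intro mult_nonneg_nonneg integral_nonneg_AE) (auto simp: indicator_def)

lemma morrey_space_measurable:
  "f \<in> morrey_space p lam \<Longrightarrow> f \<in> borel_measurable lebesgue"
  by (simp add: morrey_space_def locally_p_integrable_def)

text \<open>Local integrability speaks of compact sets; the closed ball is one, so the integral over
  the open ball is finite and its real value loses nothing.\<close>

lemma nn_integral_eq_morrey_modular: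
  fixes f :: "'a::euclidean_space \<Rightarrow> 'b::real_normed_vector"
  assumes f: "f \<in> morrey_space p lam" and r: "0 < r"
  shows "(\<integral>\<^sup>+y. ennreal (norm (f y) powr p) * indicator (ball x r) y \<partial>lebesgue)
    = ennreal (morrey_modular p lam f x r * r powr lam)"
proof -
  note [measurable] = morrey_space_measurable[OF f]
  let ?I = "\<integral>\<^sup>+y. ennreal (norm (f y) powr p) * indicator (ball x r) y \<partial>lebesgue"
  have "set_integrable lebesgue (cball x r) (\<lambda>y. norm (f y) powr p)"
    using f by (auto simp: morrey_space_def locally_p_integrable_def)
  then have "set_integrable lebesgue (ball x r) (\<lambda>y. norm (f y) powr p)"
    by (rule set_integrable_subset) auto
  then have "(\<integral>\<^sup>+y. ennreal (norm (indicat_real (ball x r) y *\<^sub>R norm (f y) powr p)) \<partial>lebesgue) < \<infinity>"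
    unfolding set_integrable_def integrable_iff_bounded by simp
  also have "(\<integral>\<^sup>+y. ennreal (norm (indicat_real (ball x r) y *\<^sub>R norm (f y) powr p)) \<partial>lebesgue) = ?I"
    by (intro nn_integral_cong) (simp add: indicator_def)
  finally have "?I = ennreal (enn2real ?I)"
    by (simp add: less_top)
  also have "enn2real ?I = morrey_modular p lam f x r * r powr lam"
    using r by (simp add: morrey_modular_def set_lebesgue_integral_ball_eq)
  finally show ?thesis .
qed

lemma morrey_modular_powr_le_norm:
  assumes "f \<in> morrey_space p lam" and "0 < r"
  shows "morrey_modular p lam f x r powr (1 / p) \<le> morrey_norm p lam f"
proof -
  have "(\<lambda>(x, r). morrey_modular p lam f x r powr (1 / p)) (x, r) \<le> morrey_norm p lam f"
    unfolding morrey_norm_def using assms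
    by (intro cSUP_upper) (auto simp: morrey_space_def)
  then show ?thesis by simp
qed

lemma morrey_norm_nonneg:
  assumes "f \<in> morrey_space p lam"
  shows "0 \<le> morrey_norm p lam f"
  using order_trans[OF powr_ge_zero morrey_modular_powr_le_norm[OF assms zero_less_one]] .

lemma morrey_modular_le_norm:
  assumes "f \<in> morrey_space p lam" and "0 < r" and "0 < p"
  shows "morrey_modular p lam f x r \<le> morrey_norm p lam f powr p"
proof -
  have "(morrey_modular p lam f x r powr (1 / p)) powr p \<le> morrey_norm p lam f powr p"
    using assms morrey_modular_powr_le_norm[OF assms(1,2)] by (intro powr_mono2) auto
  then show ?thesis
    using assms(3) by (simp add: powr_powr morrey_modular_nonneg)
qed

text \<open>A real supremum dominates its terms only if they are bounded. The Morrey norm provides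
  this bound at positive radii, which is the reason for passing to \<open>max R 1\<close>.\<close>

lemma vanishing_morrey_modular_le:
  assumes f: "f \<in> vanishing_morrey_space p lam" and "0 < p" and "0 < e"
  obtains R where "0 < R" "\<And>x r. R \<le> r \<Longrightarrow> morrey_modular p lam f x r \<le> e"
proof -
  have fm: "f \<in> morrey_space p lam"
    and lim: "((\<lambda>r. SUP x. morrey_modular p lam f x r) \<longlongrightarrow> 0) at_top"
    using f by (auto simp: vanishing_morrey_space_def)
  have "\<forall>\<^sub>F r in at_top. (SUP x. morrey_modular p lam f x r) < e"
    using order_tendstoD(2)[OF lim \<open>0 < e\<close>] .
  then obtain R where R: "\<And>r. R \<le> r \<Longrightarrow> (SUP x. morrey_modular p lam f x r) < e"
    by (auto simp: eventually_at_top_linorder)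
  have "morrey_modular p lam f x r \<le> e" if "max R 1 \<le> r" for x r
  proof -
    have "bdd_above (range (\<lambda>x. morrey_modular p lam f x r))"
      using morrey_modular_le_norm[OF fm _ \<open>0 < p\<close>] that
      by (intro bdd_aboveI2[where M = "morrey_norm p lam f powr p"]) auto
    then have "morrey_modular p lam f x r \<le> (SUP x. morrey_modular p lam f x r)"
      by (intro cSUP_upper) auto
    with R[of r] that show ?thesis by simp
  qed
  then show thesis by (intro that[of "max R 1"]) auto
qed

lemma AE_lebesgue_ballI:
  fixes P :: "'a::euclidean_space \<Rightarrow> bool"
  assumes "\<And>r. 0 < r \<Longrightarrow> AE x in lebesgue. x \<in> ball 0 r \<longrightarrow> P x"
  shows "AE x in lebesgue. P x"
proof -
  have "AE x in lebesgue. \<forall>k::nat. x \<in> ball 0 (real k + 1) \<longrightarrow> P x"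
    unfolding AE_all_countable
  proof
    fix k :: nat
    show "AE x in lebesgue. x \<in> ball 0 (real k + 1) \<longrightarrow> P x"
      by (rule assms) simp
  qed
  then show ?thesis
  proof eventually_elim
    case (elim x)
    obtain k :: nat where "norm x < real k" using reals_Archimedean2 by blast
    with elim[rule_format, of k] show ?case by simp
  qed
qed

text \<open>For \<open>lam = 0\<close> the modular is monotone in the radius, so it can only vanish at infinity when
  it is zero.\<close>

lemma vanishing_morrey_space_0:
  fixes f :: "'a::euclidean_space \<Rightarrow> 'b::real_normed_vector"
  assumes f: "f \<in> vanishing_morrey_space p 0" and p: "0 < p"
  shows "AE x in lebesgue. f x = 0"
proof (rule AE_lebesgue_ballI)
  fix r :: real assume r: "0 < r"
  have fm: "f \<in> morrey_space p 0" using f by (simp add: vanishing_morrey_space_def)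
  note [measurable] = morrey_space_measurable[OF fm]
  let ?I = "\<lambda>r. \<integral>\<^sup>+y. ennreal (norm (f y) powr p) * indicator (ball 0 r) y \<partial>lebesgue"
  have "?I r \<le> 0 + ennreal e" if e: "0 < e" for e
  proof -
    obtain R where R: "0 < R" "\<And>x r. R \<le> r \<Longrightarrow> morrey_modular p 0 f x r \<le> e"
      using vanishing_morrey_modular_le[OF f p e] by blast
    have "?I r \<le> ?I (max r R)"
      by (intro nn_integral_mono mult_left_mono) (auto simp: indicator_def)
    also have "\<dots> = ennreal (morrey_modular p 0 f 0 (max r R))"
      using nn_integral_eq_morrey_modular[OF fm, of "max r R" 0] r by simp
    also have "\<dots> \<le> ennreal e" using R by (intro ennreal_leI) auto
    finally show ?thesis by simp
  qed
  then have "?I r \<le> 0" by (rule ennreal_le_epsilon)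
  then have "?I r = 0" by simp
  then have "AE y in lebesgue. ennreal (norm (f y) powr p) * indicator (ball 0 r) y = 0"
    by (subst (asm) nn_integral_0_iff_AE) measurable
  then show "AE x in lebesgue. x \<in> ball 0 r \<longrightarrow> f x = 0"
    by eventually_elim (auto simp: indicator_def)
qed

section \<open>From the estimate on balls to the vanishing Morrey spaces\<close>

context spanne_exponents
begin

lemma riesz_nn_measurable:
  assumes [measurable]: "u \<in> borel_measurable lebesgue"
  shows "riesz_nn u \<in> borel_measurable lebesgue"
proof -
  interpret sigma_finite_measure "lebesgue :: 'a measure" by (rule sigma_finite_lebesgue)
  show ?thesis unfolding riesz_nn_def[abs_def] by measurable
qed

text \<open>\<open>near_const\<close> is known to be nonnegative only for \<open>0 < lam\<close>;
  the maximum with 0 gives a constant that serves \<open>lam = 0\<close> as well.\<close>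

definition spanne_const :: real where
  "spanne_const = max 0 (2 powr q * (near_const + far_const))"

lemma spanne_const_nonneg: "0 \<le> spanne_const"
  by (simp add: spanne_const_def)

context
  fixes f :: "'a \<Rightarrow> 'b::real_normed_vector"
  assumes f: "f \<in> vanishing_morrey_space p lam"
begin

lemma vanishing_morrey_space_morrey: "f \<in> morrey_space p lam"
  using f by (simp add: vanishing_morrey_space_def)

lemma vanishing_morrey_space_measurable [measurable]: "f \<in> borel_measurable lebesgue"
  by (rule morrey_space_measurable[OF vanishing_morrey_space_morrey])

text \<open>Disposes of \<open>lam = 0\<close>, where the near estimate breaks down:
  \<open>f\<close> is then 0 almost everywhere.\<close>

lemma riesz_nn_norm_eq_0: "lam = 0 \<Longrightarrow> riesz_nn (\<lambda>y. norm (f y)) x = 0"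
proof -
  assume "lam = 0"
  then have "AE y in lebesgue. f y = 0"
    using vanishing_morrey_space_0[of f p] f p_gt_1 by simp
  then have "AE y in lebesgue. ennreal (norm (f y) * norm (x - y) powr (\<alpha> - n)) = 0"
    by eventually_elim simp
  then show ?thesis
    unfolding riesz_nn_def by (subst nn_integral_0_iff_AE) auto
qed

lemma nn_integral_le_morrey_norm:
  assumes "0 < t"
  shows "(\<integral>\<^sup>+y. ennreal (norm (f y) powr p) * indicator (ball x t) y \<partial>lebesgue)
    \<le> ennreal (morrey_norm p lam f powr p * t powr lam)"
  unfolding nn_integral_eq_morrey_modular[OF vanishing_morrey_space_morrey assms]
  using morrey_modular_le_norm[OF vanishing_morrey_space_morrey assms] p_gt_1 by (intro ennreal_leI mult_right_mono) auto

lemma AE_riesz_nn_finite: "AE x in lebesgue. riesz_nn (\<lambda>y. norm (f y)) x < \<infinity>"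
proof (cases "lam = 0")
  case True
  then show ?thesis by (simp add: riesz_nn_norm_eq_0)
next
  case False
  show ?thesis
  proof (rule AE_lebesgue_ballI)
    fix r :: real assume r: "0 < r"
    show "AE x in lebesgue. x \<in> ball 0 r \<longrightarrow> riesz_nn (\<lambda>y. norm (f y)) x < \<infinity>"
      by (rule AE_riesz_nn_finite_ball[where E = "morrey_norm p lam f powr p" and B = "morrey_norm p lam f powr p"])
        (use False lam_nonneg r nn_integral_le_morrey_norm in auto)
  qed
qed

text \<open>The estimate on balls with \<open>B\<close> the \<open>p\<close>-th power of the norm.
  It will be used with \<open>E = B\<close> for boundedness and with small \<open>E\<close> for
  vanishing at infinity.\<close>

lemma nn_integral_riesz_nn_le:
  assumes r: "0 < r" and E: "0 \<le> E" "E \<le> morrey_norm p lam f powr p"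
    and mod: "\<And>t. r \<le> t \<Longrightarrow> morrey_modular p lam f x0 t \<le> E"
  shows "(\<integral>\<^sup>+x. ennreal (enn2real (riesz_nn (\<lambda>y. norm (f y)) x) powr q) * indicator (ball x0 r) x \<partial>lebesgue)
    \<le> ennreal (spanne_const * ((morrey_norm p lam f powr p) powr (q / p - 1) * E) * r powr \<mu>)"
proof (cases "lam = 0")
  case True
  then show ?thesis by (simp add: riesz_nn_norm_eq_0)
next
  case False
  have "(\<integral>\<^sup>+x. ennreal (enn2real (riesz_nn (\<lambda>y. norm (f y)) x) powr q) * indicator (ball x0 r) x \<partial>lebesgue)
    \<le> ennreal (2 powr q * (near_const + far_const) * ((morrey_norm p lam f powr p) powr (q / p - 1) * E) * r powr \<mu>)"
  proof (rule nn_integral_riesz_nn_ball)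
    fix t :: real assume t: "2 * r \<le> t"
    then show "(\<integral>\<^sup>+y. ennreal (norm (f y) powr p) * indicator (ball x0 t) y \<partial>lebesgue) \<le> ennreal (E * t powr lam)"
      using r mod[of t] by (subst nn_integral_eq_morrey_modular[OF vanishing_morrey_space_morrey])
        (auto intro!: ennreal_leI mult_right_mono)
  qed (use False lam_nonneg r E nn_integral_le_morrey_norm in auto)
  also have "\<dots> \<le> ennreal (spanne_const * ((morrey_norm p lam f powr p) powr (q / p - 1) * E) * r powr \<mu>)"
    using E by (intro ennreal_leI mult_right_mono) (auto simp: spanne_const_def)
  finally show ?thesis .
qed

end

text \<open>Reduces each operator to measurability and a pointwise bound by the potential of
  \<open>norm (f y)\<close>. The bound is required only where that potential is finite, that is,
  where \<open>enn2real\<close> is faithful; this is almost everywhere.\<close>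

lemma bounded_vanishing_morrey_dominated:
  fixes T :: "('a \<Rightarrow> 'b::real_normed_vector) \<Rightarrow> 'a \<Rightarrow> 'c::real_normed_vector"
  assumes K: "0 \<le> K"
    and meas: "\<And>f. f \<in> borel_measurable lebesgue \<Longrightarrow> AE x in lebesgue. riesz_nn (\<lambda>y. norm (f y)) x < \<infinity>
      \<Longrightarrow> T f \<in> borel_measurable lebesgue"
    and dom: "\<And>f. f \<in> borel_measurable lebesgue \<Longrightarrow> AE x in lebesgue. riesz_nn (\<lambda>y. norm (f y)) x < \<infinity> \<longrightarrow>
      D f x \<and> norm (T f x) \<le> K * enn2real (riesz_nn (\<lambda>y. norm (f y)) x)"
  shows "bounded_vanishing_morrey p lam q \<mu> D T"
proof -
  let ?N = "morrey_norm p lam :: ('a \<Rightarrow> 'b) \<Rightarrow> real"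
  have step: "(AE x in lebesgue. D f x) \<and> T f \<in> vanishing_morrey_space q \<mu>
      \<and> morrey_norm q \<mu> (T f) \<le> K * spanne_const powr (1 / q) * ?N f"
    if f: "f \<in> vanishing_morrey_space p lam" for f
  proof -
    note fm [measurable] = vanishing_morrey_space_measurable[OF f]
    let ?F = "\<lambda>x. enn2real (riesz_nn (\<lambda>y. norm (f y)) x)"
    have Tm [measurable]: "T f \<in> borel_measurable lebesgue"
      by (rule meas[OF fm AE_riesz_nn_finite[OF f]])
    have AE: "AE x in lebesgue. D f x \<and> norm (T f x) \<le> K * ?F x"
      using dom[OF fm] AE_riesz_nn_finite[OF f] by eventually_elim simp
    let ?B = "?N f powr p"
    let ?c = "K powr q * spanne_const * ?B powr (q / p - 1)"
    have c0: "0 \<le> ?c" using spanne_const_nonneg by simp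
    have N0: "0 \<le> ?N f" by (rule morrey_norm_nonneg[OF vanishing_morrey_space_morrey[OF f]])
    have main: "set_integrable lebesgue (ball x r) (\<lambda>y. norm (T f y) powr q) \<and> morrey_modular q \<mu> (T f) x r \<le> ?c * E"
      if r: "0 < r" and E: "0 \<le> E" "E \<le> ?B" and mod: "\<And>t. r \<le> t \<Longrightarrow> morrey_modular p lam f x t \<le> E" for x r E
    proof -
      let ?I = "\<integral>\<^sup>+y. ennreal (norm (T f y) powr q) * indicator (ball x r) y \<partial>lebesgue"
      have Fm: "riesz_nn (\<lambda>y. norm (f y)) \<in> borel_measurable lebesgue"
        by (rule riesz_nn_measurable) measurable
      then have [measurable]: "?F \<in> borel_measurable lebesgue" by measurable
      have "?I \<le> (\<integral>\<^sup>+y. ennreal (K powr q) * (ennreal (?F y powr q) * indicator (ball x r) y) \<partial>lebesgue)"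
      proof (rule nn_integral_mono_AE)
        show "AE y in lebesgue. ennreal (norm (T f y) powr q) * indicator (ball x r) y
          \<le> ennreal (K powr q) * (ennreal (?F y powr q) * indicator (ball x r) y)"
          using AE
        proof eventually_elim
          case (elim y)
          then have "norm (T f y) powr q \<le> (K * ?F y) powr q"
            using q_pos by (intro powr_mono2) auto
          then have "ennreal (norm (T f y) powr q) \<le> ennreal (K powr q) * ennreal (?F y powr q)"
            by (simp add: powr_mult ennreal_mult[symmetric] ennreal_leI)
          then show ?case by (simp add: indicator_def)
        qed
      qed
      also have "\<dots> = ennreal (K powr q) * (\<integral>\<^sup>+y. ennreal (?F y powr q) * indicator (ball x r) y \<partial>lebesgue)"
        by (rule nn_integral_cmult) measurable
      also have "\<dots> \<le> ennreal (K powr q) * ennreal (spanne_const * (?B powr (q / p - 1) * E) * r powr \<mu>)"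
        by (intro mult_left_mono nn_integral_riesz_nn_le[OF f]) (use r E mod in auto)
      also have "\<dots> = ennreal (?c * E * r powr \<mu>)"
        using E spanne_const_nonneg by (simp add: ennreal_mult'[symmetric] mult_ac)
      finally have I: "?I \<le> ennreal (?c * E * r powr \<mu>)" .
      have "morrey_modular q \<mu> (T f) x r = 1 / r powr \<mu> * enn2real ?I"
        unfolding morrey_modular_def by (subst set_lebesgue_integral_ball_eq) auto
      also have "\<dots> \<le> 1 / r powr \<mu> * (?c * E * r powr \<mu>)"
        using c0 E by (intro mult_left_mono enn2real_leI I) (auto intro!: mult_nonneg_nonneg)
      also have "\<dots> = ?c * E" using r by simp
      finally have "morrey_modular q \<mu> (T f) x r \<le> ?c * E" .
      moreover have "set_integrable lebesgue (ball x r) (\<lambda>y. norm (T f y) powr q)"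
        by (rule set_integrable_ball_of_nn_integral[OF _ _ le_less_trans[OF I]]) simp_all
      ultimately show ?thesis by simp
    qed
    have global: "set_integrable lebesgue (ball x r) (\<lambda>y. norm (T f y) powr q)"
      "morrey_modular q \<mu> (T f) x r \<le> ?c * ?B" if "0 < r" for x r
    proof -
      have "set_integrable lebesgue (ball x r) (\<lambda>y. norm (T f y) powr q) \<and> morrey_modular q \<mu> (T f) x r \<le> ?c * ?B"
      proof (rule main[OF that])
        fix t assume "r \<le> t"
        with that p_gt_1 show "morrey_modular p lam f x t \<le> ?B"
          by (intro morrey_modular_le_norm[OF vanishing_morrey_space_morrey[OF f]]) simp_all
      qed simp_all
      then show "set_integrable lebesgue (ball x r) (\<lambda>y. norm (T f y) powr q)"
        "morrey_modular q \<mu> (T f) x r \<le> ?c * ?B" by blast+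
    qed
    \<comment> \<open>The exponents of the norm add up to \<open>p * (q / p - 1) + p = q\<close>, so
      the \<open>1 / q\<close>-th power is linear in the norm.\<close>
    have "?c * ?B = K powr q * spanne_const * ?N f powr q"
    proof (cases "?N f = 0")
      case False
      have "?B powr (q / p - 1) * ?B = ?N f powr (p * (q / p - 1) + p)"
        by (simp add: powr_powr powr_add)
      also have "p * (q / p - 1) + p = q" using p_gt_1 by (simp add: algebra_simps)
      finally show ?thesis by (simp add: mult.assoc)
    qed simp
    also have "\<dots> powr (1 / q) = K * spanne_const powr (1 / q) * ?N f"
      using q_pos K N0 by (simp add: powr_mult powr_powr)
    finally have cB: "(?c * ?B) powr (1 / q) = K * spanne_const powr (1 / q) * ?N f" .
    have le: "morrey_modular q \<mu> (T f) x r powr (1 / q) \<le> K * spanne_const powr (1 / q) * ?N f"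
      if "0 < r" for x r
      unfolding cB[symmetric] using global(2)[OF that] q_pos
      by (intro powr_mono2) (auto simp: morrey_modular_nonneg)
    have loc: "locally_p_integrable q (T f)"
      unfolding locally_p_integrable_def
    proof (intro conjI allI impI Tm)
      fix S :: "'a set" assume S: "compact S"
      then obtain r where r: "0 < r" "S \<subseteq> ball 0 r"
        using bounded_subset_ballD[OF compact_imp_bounded, of S 0] by blast
      have "S \<in> sets lebesgue" using S by (simp add: lmeasurable_compact fmeasurableD)
      with r global(1)[OF r(1)] show "set_integrable lebesgue S (\<lambda>y. norm (T f y) powr q)"
        by (intro set_integrable_subset[OF global(1)])
    qed
    have mor: "T f \<in> morrey_space q \<mu>"
      unfolding morrey_space_def using loc le
      by (auto intro!: bdd_aboveI2[where M = "K * spanne_const powr (1 / q) * ?N f"])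
    have norm: "morrey_norm q \<mu> (T f) \<le> K * spanne_const powr (1 / q) * ?N f"
      unfolding morrey_norm_def[of q \<mu>] by (rule cSUP_least) (use le in auto)
    have "((\<lambda>r. SUP x. morrey_modular q \<mu> (T f) x r) \<longlongrightarrow> 0) at_top"
    proof (rule tendstoI)
      fix e :: real assume e: "0 < e"
      \<comment> \<open>The summand 1 allows for \<open>?c = 0\<close>. The factor 2 leaves room
        because a supremum of terms at most \<open>e / 2\<close> is still strictly below
        \<open>e\<close>.\<close>
      let ?d = "e / (2 * (?c + 1))"
      have d: "0 < ?d" using e c0 by simp
      obtain R where R: "0 < R" "\<And>x r. R \<le> r \<Longrightarrow> morrey_modular p lam f x r \<le> ?d"
        using vanishing_morrey_modular_le[OF f less_trans[OF zero_less_one p_gt_1] d] by blast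
      have "dist (SUP x. morrey_modular q \<mu> (T f) x r) 0 < e" if r: "R \<le> r" for r
      proof -
        have m: "morrey_modular q \<mu> (T f) x r \<le> e / 2" for x
        proof -
          \<comment> \<open>The minimum is taken because \<open>main\<close> requires
            \<open>E \<le> ?B\<close>.\<close>
          have "morrey_modular q \<mu> (T f) x r \<le> ?c * min ?d ?B"
          proof (rule conjunct2[OF main])
            fix t assume "r \<le> t"
            with R r p_gt_1 show "morrey_modular p lam f x t \<le> min ?d ?B"
              by (intro min.boundedI R(2) morrey_modular_le_norm[OF vanishing_morrey_space_morrey[OF f]]) simp_all
          qed (use R r d in simp_all)
          also have "\<dots> \<le> ?c * ?d" using c0 by (intro mult_left_mono) auto
          also have "\<dots> \<le> e / 2" using c0 e by (simp add: field_simps)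
          finally show ?thesis .
        qed
        have "(SUP x. morrey_modular q \<mu> (T f) x r) \<le> e / 2"
          by (rule cSUP_least) (use m in auto)
        \<comment> \<open>The distance to 0 is an absolute value, so a lower bound is needed too;
          for a real supremum it depends on boundedness above.\<close>
        moreover have "0 \<le> (SUP x. morrey_modular q \<mu> (T f) x r)"
          using m by (intro cSUP_upper2[of _ _ 0] morrey_modular_nonneg) (auto intro!: bdd_aboveI2[where M = "e / 2"])
        ultimately show ?thesis using e by simp
      qed
      then show "\<forall>\<^sub>F r in at_top. dist (SUP x. morrey_modular q \<mu> (T f) x r) 0 < e"
        by (auto simp: eventually_at_top_linorder)
    qed
    with mor norm AE show ?thesis by (auto simp: vanishing_morrey_space_def)
  qed
  then show ?thesis unfolding bounded_vanishing_morrey_def by blast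
qed

end

section \<open>Operators dominated by the Riesz potential\<close>

text \<open>Completeness of Lebesgue measure: the two preimages differ only inside a null set, all
  of whose subsets are measurable.\<close>

lemma borel_measurable_lebesgue_AE_eq:
  fixes f g :: "'a::euclidean_space \<Rightarrow> 'c::topological_space"
  assumes g [measurable]: "g \<in> borel_measurable lebesgue" and AE: "AE x in lebesgue. f x = g x"
  shows "f \<in> borel_measurable lebesgue"
proof (rule measurableI)
  obtain N where N: "N \<in> null_sets (lebesgue :: 'a measure)" "{x. f x \<noteq> g x} \<subseteq> N"
    using AE by (auto simp: eventually_ae_filter)
  fix A :: "'c set" assume A: "A \<in> sets borel"
  have "f -` A \<inter> N \<in> null_sets lebesgue"
    by (rule null_sets_completion_subset[OF _ N(1)]) auto
  moreover have "g -` A \<in> sets lebesgue"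
    using measurable_sets[OF g A] by simp
  moreover have "f -` A = (g -` A - N) \<union> (f -` A \<inter> N)"
    using N(2) by auto
  moreover have "N \<in> sets lebesgue" using N by auto
  ultimately have "f -` A \<in> sets lebesgue"
    by (metis null_setsD2 sets.Diff sets.Un)
  then show "f -` A \<inter> space lebesgue \<in> sets lebesgue" by simp
qed simp

lemma AE_lebesgue_neq: "AE y in lebesgue. y \<noteq> (x :: 'a::euclidean_space)"
  by (rule AE_I'[of "{x}"]) auto

lemma fractional_average_nonneg: "0 \<le> fractional_average \<alpha> f x t"
  unfolding fractional_average_def set_lebesgue_integral_def
  by (intro mult_nonneg_nonneg integral_nonneg_AE) (auto simp: indicator_def)

section \<open>Integral operators: the Riesz potential and the Hardy operators\<close>

context spanne_exponents
begin

text \<open>One domination yields both absolute convergence and the norm bound. The constant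
  \<open>c\<close> may depend on \<open>x\<close>, as it does for the Hardy operators.\<close>

lemma integral_riesz_dominated:
  fixes g :: "'a \<Rightarrow> 'c::{banach, second_countable_topology}"
  assumes [measurable]: "g \<in> borel_measurable lebesgue" "u \<in> borel_measurable lebesgue"
    and u0: "\<And>y. 0 \<le> u y" and fin: "riesz_nn u x < \<infinity>"
    and dom: "AE y in lebesgue. norm (g y) \<le> c * (u y * norm (x - y) powr (\<alpha> - n))"
  shows "integrable lebesgue g" "norm (integral\<^sup>L lebesgue g) \<le> c * enn2real (riesz_nn u x)"
proof -
  let ?k = "\<lambda>y. u y * norm (x - y) powr (\<alpha> - n)"
  have k: "integrable lebesgue ?k"
    using fin u0 by (intro integrableI_bounded) (simp_all add: riesz_nn_def)
  have ki: "integral\<^sup>L lebesgue ?k = enn2real (riesz_nn u x)"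
    unfolding riesz_nn_def using u0 by (intro integral_eq_nn_integral) auto
  have ck: "integrable lebesgue (\<lambda>y. c * ?k y)" using k by simp
  have "AE y in lebesgue. norm (g y) \<le> norm (c * ?k y)"
    using dom by eventually_elim (metis order_trans abs_ge_self real_norm_def)
  then show g: "integrable lebesgue g"
    by (intro Bochner_Integration.integrable_bound[OF ck]) measurable
  have "norm (integral\<^sup>L lebesgue g) \<le> (LINT y|lebesgue. norm (g y))"
    by (rule integral_norm_bound)
  also have "\<dots> \<le> (LINT y|lebesgue. c * ?k y)"
    using g ck dom by (intro integral_mono_AE) auto
  also have "\<dots> = c * enn2real (riesz_nn u x)" by (simp add: ki)
  finally show "norm (integral\<^sup>L lebesgue g) \<le> c * enn2real (riesz_nn u x)" .
qed

lemma bounded_riesz_potential: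
  "bounded_vanishing_morrey p lam q \<mu> (riesz_potential_defined \<alpha>)
    (riesz_potential \<alpha> :: ('a \<Rightarrow> 'b::{banach, second_countable_topology}) \<Rightarrow> 'a \<Rightarrow> 'b)"
proof (rule bounded_vanishing_morrey_dominated[where K = 1])
  interpret sigma_finite_measure "lebesgue :: 'a measure" by (rule sigma_finite_lebesgue)
  fix f :: "'a \<Rightarrow> 'b" assume f [measurable]: "f \<in> borel_measurable lebesgue"
  show "riesz_potential \<alpha> f \<in> borel_measurable lebesgue"
    unfolding riesz_potential_def[abs_def] by measurable
  have "riesz_potential_defined \<alpha> f x \<and> norm (riesz_potential \<alpha> f x) \<le> 1 * enn2real (riesz_nn (\<lambda>y. norm (f y)) x)"
    if "riesz_nn (\<lambda>y. norm (f y)) x < \<infinity>" for x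
  proof -
    have dom: "AE y in lebesgue. norm (f y /\<^sub>R norm (x - y) powr (n - \<alpha>)) \<le> 1 * (norm (f y) * norm (x - y) powr (\<alpha> - n))"
      by (simp add: powr_minus[of _ "n - \<alpha>", simplified] mult.commute)
    show ?thesis
      unfolding riesz_potential_defined_def riesz_potential_def n_eq[symmetric]
      by (intro conjI integral_riesz_dominated[OF _ _ _ that dom]) (simp_all, measurable)
  qed
  then show "AE x in lebesgue. riesz_nn (\<lambda>y. norm (f y)) x < \<infinity> \<longrightarrow> riesz_potential_defined \<alpha> f x
      \<and> norm (riesz_potential \<alpha> f x) \<le> 1 * enn2real (riesz_nn (\<lambda>y. norm (f y)) x)"
    by simp
qed simp

text \<open>If \<open>norm y < norm x\<close>, then \<open>norm (x - y) \<le> 2 * norm x\<close>, so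
  the Riesz kernel is at least \<open>(2 * norm x) powr (\<alpha> - n)\<close>; its reciprocal
  cancels the prefactor up to \<open>2 powr (n - \<alpha>)\<close>. At \<open>x = 0\<close> the
  domain of integration is empty.\<close>

lemma bounded_hardy_inner:
  "bounded_vanishing_morrey p lam q \<mu> (hardy_inner_defined \<alpha>)
    (hardy_inner \<alpha> :: ('a \<Rightarrow> 'b::{banach, second_countable_topology}) \<Rightarrow> 'a \<Rightarrow> 'b)"
proof (rule bounded_vanishing_morrey_dominated[where K = "2 powr (n - \<alpha>)"])
  interpret sigma_finite_measure "lebesgue :: 'a measure" by (rule sigma_finite_lebesgue)
  fix f :: "'a \<Rightarrow> 'b" assume f [measurable]: "f \<in> borel_measurable lebesgue"
  show "hardy_inner \<alpha> f \<in> borel_measurable lebesgue"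
    unfolding hardy_inner_def[abs_def] set_lebesgue_integral_def indicator_def mem_Collect_eq
    by measurable
  have "hardy_inner_defined \<alpha> f x \<and> norm (hardy_inner \<alpha> f x) \<le> 2 powr (n - \<alpha>) * enn2real (riesz_nn (\<lambda>y. norm (f y)) x)"
    if fin: "riesz_nn (\<lambda>y. norm (f y)) x < \<infinity>" for x
  proof (cases "x = 0")
    case True
    then show ?thesis
      by (simp add: hardy_inner_defined_def hardy_inner_def set_integrable_def set_lebesgue_integral_def)
  next
    case False
    let ?g = "\<lambda>y. indicat_real {y. norm y < norm x} y *\<^sub>R f y"
    let ?c = "(2 * norm x) powr (n - \<alpha>)"
    have [measurable]: "?g \<in> borel_measurable lebesgue"
      unfolding indicator_def mem_Collect_eq by measurable
    have dom: "AE y in lebesgue. norm (?g y) \<le> ?c * (norm (f y) * norm (x - y) powr (\<alpha> - n))"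
    proof (rule AE_I2)
      fix y
      show "norm (?g y) \<le> ?c * (norm (f y) * norm (x - y) powr (\<alpha> - n))"
      proof (cases "norm y < norm x")
        case True
        then have "0 < norm (x - y)" "norm (x - y) \<le> 2 * norm x"
          using norm_triangle_ineq4[of x y] by auto
        then have "(2 * norm x) powr (\<alpha> - n) \<le> norm (x - y) powr (\<alpha> - n)"
          using \<alpha>_less by (intro powr_mono2') auto
        then have "?c * (2 * norm x) powr (\<alpha> - n) * norm (f y) \<le> ?c * norm (x - y) powr (\<alpha> - n) * norm (f y)"
          by (intro mult_right_mono mult_left_mono) auto
        moreover have "?c * (2 * norm x) powr (\<alpha> - n) = 1"
          using False by (simp flip: powr_add)
        ultimately show ?thesis using True by (simp add: mult_ac)
      qed simp
    qed
    note d = integral_riesz_dominated[OF _ _ _ fin dom]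
    have "norm (hardy_inner \<alpha> f x) = norm x powr (\<alpha> - n) * norm (integral\<^sup>L lebesgue ?g)"
      by (simp add: hardy_inner_def set_lebesgue_integral_def n_eq)
    also have "\<dots> \<le> norm x powr (\<alpha> - n) * (?c * enn2real (riesz_nn (\<lambda>y. norm (f y)) x))"
      by (intro mult_left_mono d) (simp_all, measurable)
    also have "\<dots> = (norm x powr (\<alpha> - n) * norm x powr (n - \<alpha>)) * 2 powr (n - \<alpha>) * enn2real (riesz_nn (\<lambda>y. norm (f y)) x)"
      by (simp add: powr_mult)
    also have "norm x powr (\<alpha> - n) * norm x powr (n - \<alpha>) = 1"
      using False by (simp flip: powr_add)
    finally show ?thesis
      using d(1) by (simp add: hardy_inner_defined_def set_integrable_def)
  qed
  then show "AE x in lebesgue. riesz_nn (\<lambda>y. norm (f y)) x < \<infinity> \<longrightarrow> hardy_inner_defined \<alpha> f x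
      \<and> norm (hardy_inner \<alpha> f x) \<le> 2 powr (n - \<alpha>) * enn2real (riesz_nn (\<lambda>y. norm (f y)) x)"
    by simp
qed simp

text \<open>For \<open>norm y > norm x\<close>, split \<open>|y|^(-n)\<close> into
  \<open>|y|^(-\<alpha>)\<close>, at most \<open>|x|^(-\<alpha>)\<close>, and
  \<open>|y|^(\<alpha> - n)\<close>, which the Riesz kernel dominates because
  \<open>norm (x - y) \<le> 2 * norm y\<close>. The origin, where \<open>|x|^(-\<alpha>)\<close>
  gives no bound, is discarded as a null set.\<close>

lemma bounded_hardy_outer:
  "bounded_vanishing_morrey p lam q \<mu> (hardy_outer_defined \<alpha>)
    (hardy_outer \<alpha> :: ('a \<Rightarrow> 'b::{banach, second_countable_topology}) \<Rightarrow> 'a \<Rightarrow> 'b)"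
proof (rule bounded_vanishing_morrey_dominated[where K = "2 powr (n - \<alpha>)"])
  interpret sigma_finite_measure "lebesgue :: 'a measure" by (rule sigma_finite_lebesgue)
  fix f :: "'a \<Rightarrow> 'b" assume f [measurable]: "f \<in> borel_measurable lebesgue"
  show "hardy_outer \<alpha> f \<in> borel_measurable lebesgue"
    unfolding hardy_outer_def[abs_def] set_lebesgue_integral_def indicator_def mem_Collect_eq
    by measurable
  have "hardy_outer_defined \<alpha> f x \<and> norm (hardy_outer \<alpha> f x) \<le> 2 powr (n - \<alpha>) * enn2real (riesz_nn (\<lambda>y. norm (f y)) x)"
    if fin: "riesz_nn (\<lambda>y. norm (f y)) x < \<infinity>" and x: "x \<noteq> 0" for x
  proof -
    let ?g = "\<lambda>y. indicat_real {y. norm y > norm x} y *\<^sub>R (f y /\<^sub>R norm y ^ DIM('a))"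
    let ?c = "2 powr (n - \<alpha>) * norm x powr (-\<alpha>)"
    have [measurable]: "?g \<in> borel_measurable lebesgue"
      unfolding indicator_def mem_Collect_eq by measurable
    have dom: "AE y in lebesgue. norm (?g y) \<le> ?c * (norm (f y) * norm (x - y) powr (\<alpha> - n))"
    proof (rule AE_I2)
      fix y
      show "norm (?g y) \<le> ?c * (norm (f y) * norm (x - y) powr (\<alpha> - n))"
      proof (cases "norm x < norm y")
        case True
        then have y: "0 < norm y" "0 < norm (x - y)" "norm (x - y) \<le> 2 * norm y"
          using norm_triangle_ineq4[of x y] norm_ge_zero[of x] by (auto simp del: norm_ge_zero)
        have "1 / norm y ^ DIM('a) = norm y powr (-\<alpha>) * norm y powr (\<alpha> - n)"
        proof -
          have "1 / norm y ^ DIM('a) = norm y powr (- n)"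
            using y by (simp add: n_eq powr_minus_divide powr_realpow)
          then show ?thesis by (simp flip: powr_add)
        qed
        also have "\<dots> = 2 powr (n - \<alpha>) * norm y powr (-\<alpha>) * (2 * norm y) powr (\<alpha> - n)"
        proof -
          have "2 powr (n - \<alpha>) * 2 powr (\<alpha> - n) = (1 :: real)" by (simp flip: powr_add)
          then show ?thesis by (simp add: powr_mult)
        qed
        also have "\<dots> \<le> 2 powr (n - \<alpha>) * norm x powr (-\<alpha>) * norm (x - y) powr (\<alpha> - n)"
          using y True x \<alpha>_less \<alpha>_pos by (intro mult_mono[OF mult_left_mono[OF powr_mono2'] powr_mono2']) auto
        finally have "norm (f y) * (1 / norm y ^ DIM('a)) \<le> norm (f y) * (?c * norm (x - y) powr (\<alpha> - n))"
          by (intro mult_left_mono) auto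
        then show ?thesis using True by (simp add: divide_inverse mult_ac)
      qed simp
    qed
    note d = integral_riesz_dominated[OF _ _ _ fin dom]
    have "norm (hardy_outer \<alpha> f x) = norm x powr \<alpha> * norm (integral\<^sup>L lebesgue ?g)"
      by (simp add: hardy_outer_def set_lebesgue_integral_def)
    also have "\<dots> \<le> norm x powr \<alpha> * (?c * enn2real (riesz_nn (\<lambda>y. norm (f y)) x))"
      by (intro mult_left_mono d) (simp_all, measurable)
    also have "\<dots> = (norm x powr \<alpha> * norm x powr (-\<alpha>)) * 2 powr (n - \<alpha>) * enn2real (riesz_nn (\<lambda>y. norm (f y)) x)"
      by simp
    also have "norm x powr \<alpha> * norm x powr (-\<alpha>) = 1"
      using x by (simp flip: powr_add)
    finally show ?thesis
      using d(1) by (simp add: hardy_outer_defined_def set_integrable_def)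
  qed
  then show "AE x in lebesgue. riesz_nn (\<lambda>y. norm (f y)) x < \<infinity> \<longrightarrow> hardy_outer_defined \<alpha> f x
      \<and> norm (hardy_outer \<alpha> f x) \<le> 2 powr (n - \<alpha>) * enn2real (riesz_nn (\<lambda>y. norm (f y)) x)"
    using AE_lebesgue_neq[of 0] by (auto elim!: eventually_mono)
qed simp

section \<open>The fractional maximal operator\<close>

context
  fixes f :: "'a \<Rightarrow> 'b::{banach, second_countable_topology}" and x :: 'a
  assumes f [measurable]: "f \<in> borel_measurable lebesgue"
    and fin: "riesz_nn (\<lambda>y. norm (f y)) x < \<infinity>"
begin

abbreviation (input) "R \<equiv> enn2real (riesz_nn (\<lambda>y. norm (f y)) x)"

text \<open>On \<open>ball x t\<close> the Riesz kernel is at least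
  \<open>t powr (\<alpha> - n)\<close>, except at \<open>y = x\<close>, where
  \<open>0 powr (\<alpha> - n) = 0\<close>; hence the domination holds almost everywhere.\<close>

lemma set_integral_ball_le_riesz:
  assumes t: "0 < t"
  shows "set_integrable lebesgue (ball x t) (\<lambda>y. norm (f y))"
    "(LINT y:ball x t|lebesgue. norm (f y)) \<le> t powr (n - \<alpha>) * R"
proof -
  let ?g = "\<lambda>y. indicat_real (ball x t) y *\<^sub>R norm (f y)"
  have dom: "AE y in lebesgue. norm (?g y) \<le> t powr (n - \<alpha>) * (norm (f y) * norm (x - y) powr (\<alpha> - n))"
    using AE_lebesgue_neq[of x]
  proof eventually_elim
    case (elim y)
    show ?case
    proof (cases "y \<in> ball x t")
      case True
      with elim have "0 < norm (x - y)" "norm (x - y) \<le> t" by (auto simp: dist_norm)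
      then have "t powr (\<alpha> - n) \<le> norm (x - y) powr (\<alpha> - n)"
        using \<alpha>_less by (intro powr_mono2') auto
      then have "t powr (n - \<alpha>) * t powr (\<alpha> - n) * norm (f y)
        \<le> t powr (n - \<alpha>) * norm (x - y) powr (\<alpha> - n) * norm (f y)"
        by (intro mult_right_mono mult_left_mono) auto
      moreover have "t powr (n - \<alpha>) * t powr (\<alpha> - n) = 1"
        using t by (simp flip: powr_add)
      ultimately show ?thesis using True by (simp add: mult_ac)
    qed simp
  qed
  have "integrable lebesgue ?g \<and> norm (integral\<^sup>L lebesgue ?g) \<le> t powr (n - \<alpha>) * R"
    by (intro conjI integral_riesz_dominated[OF _ _ _ fin dom]) (simp_all, measurable)
  then show "set_integrable lebesgue (ball x t) (\<lambda>y. norm (f y))"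
    "(LINT y:ball x t|lebesgue. norm (f y)) \<le> t powr (n - \<alpha>) * R"
    unfolding set_integrable_def set_lebesgue_integral_def by auto
qed

lemma fractional_average_eq:
  assumes "0 < t"
  shows "fractional_average \<alpha> f x t
    = unit_ball_vol n powr (\<alpha> / n - 1) * (t powr (\<alpha> - n) * (LINT y:ball x t|lebesgue. norm (f y)))"
proof -
  have "measure lebesgue (ball x t) = unit_ball_vol n * t powr n"
    using assms by (simp add: content_ball n_eq powr_realpow)
  then have "1 / measure lebesgue (ball x t) powr (1 - \<alpha> / n) = (unit_ball_vol n * t powr n) powr (\<alpha> / n - 1)"
    by (simp add: powr_minus_divide[symmetric])
  also have "\<dots> = unit_ball_vol n powr (\<alpha> / n - 1) * t powr (\<alpha> - n)"
    using n_pos by (simp add: powr_mult powr_powr right_diff_distrib)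
  finally show ?thesis by (simp add: fractional_average_def n_eq[symmetric])
qed

lemma fractional_average_le_riesz:
  assumes t: "0 < t"
  shows "fractional_average \<alpha> f x t \<le> unit_ball_vol n powr (\<alpha> / n - 1) * R"
proof -
  have "t powr (\<alpha> - n) * (LINT y:ball x t|lebesgue. norm (f y)) \<le> t powr (\<alpha> - n) * (t powr (n - \<alpha>) * R)"
    by (intro mult_left_mono set_integral_ball_le_riesz t) auto
  also have "\<dots> = (t powr (\<alpha> - n) * t powr (n - \<alpha>)) * R" by simp
  also have "t powr (\<alpha> - n) * t powr (n - \<alpha>) = 1" using t by (simp flip: powr_add)
  finally show ?thesis
    unfolding fractional_average_eq[OF t] by (intro mult_left_mono) auto
qed

lemma bdd_above_fractional_average: "bdd_above (fractional_average \<alpha> f x ` {0<..})"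
  by (intro bdd_aboveI2[where M = "unit_ball_vol n powr (\<alpha> / n - 1) * R"])
    (auto intro: fractional_average_le_riesz)

text \<open>The integral grows with the radius and only the normalisation changes. The factor tends
  to 1 as \<open>s\<close> decreases to \<open>t\<close>, which replaces continuity in the
  radius.\<close>

lemma fractional_average_quasi_mono:
  assumes t: "0 < t" "t \<le> s"
  shows "fractional_average \<alpha> f x t \<le> (s / t) powr (n - \<alpha>) * fractional_average \<alpha> f x s"
proof -
  have s: "0 < s" using t by simp
  have "(LINT y:ball x t|lebesgue. norm (f y)) \<le> (LINT y:ball x s|lebesgue. norm (f y))"
    using t set_integral_ball_le_riesz(1)[OF t(1)] set_integral_ball_le_riesz(1)[OF s]
    unfolding set_lebesgue_integral_def set_integrable_def
    by (intro integral_mono) (auto simp: indicator_def)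
  then have "unit_ball_vol n powr (\<alpha> / n - 1) * (t powr (\<alpha> - n) * (LINT y:ball x t|lebesgue. norm (f y)))
    \<le> unit_ball_vol n powr (\<alpha> / n - 1) * (t powr (\<alpha> - n) * (LINT y:ball x s|lebesgue. norm (f y)))"
    by (intro mult_left_mono) auto
  moreover have "t powr (\<alpha> - n) = (s / t) powr (n - \<alpha>) * s powr (\<alpha> - n)"
    using t s by (simp add: powr_divide powr_diff)
  ultimately show ?thesis
    unfolding fractional_average_eq[OF t(1)] fractional_average_eq[OF s] by (simp add: mult_ac)
qed

text \<open>Makes the supremum countable, for measurability. If the average at some \<open>t\<close>
  exceeded the supremum \<open>M\<close> over rational radii, a rational \<open>s\<close> slightly
  larger than \<open>t\<close> would contradict \<open>fractional_average_quasi_mono\<close>. Taken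
  in \<open>ennreal\<close>, the right-hand side makes sense at every point.\<close>

lemma fractional_maximal_eq_rational:
  "ennreal (fractional_maximal \<alpha> f x) = (SUP s\<in>\<rat> \<inter> {0<..}. ennreal (fractional_average \<alpha> f x s))"
    (is "_ = ?S")
proof (rule antisym)
  have le: "fractional_average \<alpha> f x t \<le> fractional_maximal \<alpha> f x" if "0 < t" for t
    unfolding fractional_maximal_def using that by (intro cSUP_upper bdd_above_fractional_average) auto
  show S: "?S \<le> ennreal (fractional_maximal \<alpha> f x)"
    by (intro SUP_least ennreal_leI le) auto
  have "?S \<noteq> \<infinity>" using less_imp_neq[OF le_less_trans[OF S ennreal_less_top]] by (simp only: infinity_ennreal_def not_False_eq_True)
  then obtain M where M: "0 \<le> M" "?S = ennreal M" by (cases ?S) auto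
  have rat: "fractional_average \<alpha> f x s \<le> M" if "s \<in> \<rat>" "0 < s" for s
  proof -
    have "ennreal (fractional_average \<alpha> f x s) \<le> ?S" using that by (intro SUP_upper) auto
    then show ?thesis unfolding M(2) by (simp only: ennreal_le_iff[OF M(1)])
  qed
  have "fractional_average \<alpha> f x t \<le> M" if t: "0 < t" for t
  proof (rule ccontr)
    assume *: "\<not> fractional_average \<alpha> f x t \<le> M"
    have "((\<lambda>s. (s / t) powr (n - \<alpha>) * M) \<longlongrightarrow> (t / t) powr (n - \<alpha>) * M) (at_right t)"
      using t by (intro tendsto_intros) auto
    then have "\<forall>\<^sub>F s in at_right t. (s / t) powr (n - \<alpha>) * M < fractional_average \<alpha> f x t"
      using * t by (intro order_tendstoD(2)[where y = M]) auto
    then obtain b where b: "t < b" "\<And>s. t < s \<Longrightarrow> s < b \<Longrightarrow> (s / t) powr (n - \<alpha>) * M < fractional_average \<alpha> f x t"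
      by (auto simp: eventually_at_right_field)
    obtain s where s: "s \<in> \<rat>" "t < s" "s < b" using Rats_dense_in_real[OF b(1)] by blast
    have "fractional_average \<alpha> f x t \<le> (s / t) powr (n - \<alpha>) * fractional_average \<alpha> f x s"
      using s t by (intro fractional_average_quasi_mono) auto
    also have "\<dots> \<le> (s / t) powr (n - \<alpha>) * M"
      using s t by (intro mult_left_mono rat) auto
    finally show False using b(2)[OF s(2,3)] by simp
  qed
  then have "fractional_maximal \<alpha> f x \<le> M"
    unfolding fractional_maximal_def by (intro cSUP_least) auto
  then show "ennreal (fractional_maximal \<alpha> f x) \<le> ?S"
    unfolding M(2) by (rule ennreal_leI)
qed

lemma fractional_maximal_nonneg: "0 \<le> fractional_maximal \<alpha> f x"
  unfolding fractional_maximal_def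
  by (intro cSUP_upper2[of _ _ 1] bdd_above_fractional_average fractional_average_nonneg) auto

lemma fractional_maximal_le_riesz:
  "fractional_maximal \<alpha> f x \<le> unit_ball_vol n powr (\<alpha> / n - 1) * R"
  unfolding fractional_maximal_def by (intro cSUP_least fractional_average_le_riesz) auto

end

text \<open>Where the potential is finite, the maximal function is a countable supremum of
  measurable functions; on the remaining null set completeness takes over.\<close>

lemma fractional_maximal_measurable:
  fixes f :: "'a \<Rightarrow> 'b::{banach, second_countable_topology}"
  assumes f [measurable]: "f \<in> borel_measurable lebesgue"
    and AE: "AE x in lebesgue. riesz_nn (\<lambda>y. norm (f y)) x < \<infinity>"
  shows "fractional_maximal \<alpha> f \<in> borel_measurable lebesgue"
proof (rule borel_measurable_lebesgue_AE_eq)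
  interpret sigma_finite_measure "lebesgue :: 'a measure" by (rule sigma_finite_lebesgue)
  have "(\<lambda>x. ennreal (fractional_average \<alpha> f x s)) \<in> borel_measurable lebesgue" if "0 < s" for s
  proof -
    have [measurable]: "(\<lambda>x. LINT y:ball x s|lebesgue. norm (f y)) \<in> borel_measurable lebesgue"
      unfolding set_lebesgue_integral_def indicator_def mem_ball by measurable
    \<comment> \<open>The volume of a ball does not depend on its centre, so \<open>x\<close> occurs
      only in the integral.\<close>
    have "fractional_average \<alpha> f x s
        = 1 / measure lebesgue (ball (0::'a) s) powr (1 - \<alpha> / real DIM('a)) * (LINT y:ball x s|lebesgue. norm (f y))" for x
      using that by (simp add: fractional_average_def content_ball)
    then show ?thesis by (simp only:) measurable
  qed
  then have "(\<lambda>x. SUP s\<in>\<rat> \<inter> {0<..}. ennreal (fractional_average \<alpha> f x s)) \<in> borel_measurable lebesgue"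
    by (intro borel_measurable_SUP countable_Int1 countable_rat) auto
  then show "(\<lambda>x. enn2real (SUP s\<in>\<rat> \<inter> {0<..}. ennreal (fractional_average \<alpha> f x s))) \<in> borel_measurable lebesgue"
    by (rule measurable_compose) measurable
  show "AE x in lebesgue. fractional_maximal \<alpha> f x
      = enn2real (SUP s\<in>\<rat> \<inter> {0<..}. ennreal (fractional_average \<alpha> f x s))"
    using AE
  proof eventually_elim
    case (elim x)
    show ?case
      unfolding fractional_maximal_eq_rational[OF f elim, symmetric]
      using fractional_maximal_nonneg[OF f elim] by simp
  qed
qed

lemma bounded_fractional_maximal:
  "bounded_vanishing_morrey p lam q \<mu> (fractional_maximal_defined \<alpha>)
    (fractional_maximal \<alpha> :: ('a \<Rightarrow> 'b::{banach, second_countable_topology}) \<Rightarrow> 'a \<Rightarrow> real)"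
proof (rule bounded_vanishing_morrey_dominated[where K = "unit_ball_vol n powr (\<alpha> / n - 1)"])
  fix f :: "'a \<Rightarrow> 'b" assume f: "f \<in> borel_measurable lebesgue"
  show "AE x in lebesgue. riesz_nn (\<lambda>y. norm (f y)) x < \<infinity> \<longrightarrow> fractional_maximal_defined \<alpha> f x
      \<and> norm (fractional_maximal \<alpha> f x) \<le> unit_ball_vol n powr (\<alpha> / n - 1) * enn2real (riesz_nn (\<lambda>y. norm (f y)) x)"
  proof (intro AE_I2 impI conjI)
    fix x assume fin: "riesz_nn (\<lambda>y. norm (f y)) x < \<infinity>"
    show "fractional_maximal_defined \<alpha> f x"
      unfolding fractional_maximal_defined_def
      using set_integral_ball_le_riesz(1)[OF f fin] bdd_above_fractional_average[OF f fin] by blast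
    show "norm (fractional_maximal \<alpha> f x) \<le> unit_ball_vol n powr (\<alpha> / n - 1) * enn2real (riesz_nn (\<lambda>y. norm (f y)) x)"
      using fractional_maximal_nonneg[OF f fin] fractional_maximal_le_riesz[OF f fin] by simp
  qed
qed (simp_all add: fractional_maximal_measurable)

end

theorem theorem3p3:
  fixes \<alpha> p q lam \<mu> :: real
  assumes "0 < \<alpha>" and "\<alpha> < real DIM('a::euclidean_space)"
    and "1 < p" and "p < real DIM('a) / \<alpha>"
    and "0 \<le> lam" and "lam < real DIM('a) - \<alpha> * p"
    and "1 / q = 1 / p - \<alpha> / real DIM('a)"
    and "lam / p = \<mu> / q"
  shows "bounded_vanishing_morrey p lam q \<mu> (riesz_potential_defined \<alpha>)
           (riesz_potential \<alpha> ::
              ('a \<Rightarrow> 'b::{real_normed_field, banach, second_countable_topology}) \<Rightarrow> 'a \<Rightarrow> 'b) \<and>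
         bounded_vanishing_morrey p lam q \<mu> (fractional_maximal_defined \<alpha>)
           (fractional_maximal \<alpha> :: ('a \<Rightarrow> 'b) \<Rightarrow> 'a \<Rightarrow> real) \<and>
         bounded_vanishing_morrey p lam q \<mu> (hardy_inner_defined \<alpha>)
           (hardy_inner \<alpha> :: ('a \<Rightarrow> 'b) \<Rightarrow> 'a \<Rightarrow> 'b) \<and>
         bounded_vanishing_morrey p lam q \<mu> (hardy_outer_defined \<alpha>)
           (hardy_outer \<alpha> :: ('a \<Rightarrow> 'b) \<Rightarrow> 'a \<Rightarrow> 'b)"
proof -
  interpret spanne_exponents "TYPE('a)" "real DIM('a)" \<alpha> p q lam \<mu>
    using assms by unfold_locales auto
  show ?thesis
    by (intro conjI bounded_riesz_potential bounded_fractional_maximal bounded_hardy_inner bounded_hardy_outer)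
qed

end
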